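(* Consider the planar Newtonian four-body problem with masses $m_1=m_2=1$, $m_3=m_4=m>0$. Let $G=D_L$ be a dihedral group of order $2L$ with generators $h_1,h_2$, acting with $\sigma(h_1)=(1\,2)(3\,4)$, $\sigma(h_2)=(1\,2)$, and with $\rho(h_1)$, $\rho(h_2)$ the reflections of the plane along lines $l_1$, $l_2$ through the origin which neither coincide nor are orthogonal. Assume that all local minima of $\mathcal{A}^G$ in $\Lambda^G$ are collision-free. Then $\mathcal{A}^G$ is coercive and attains its minimum on $\Lambda^G$, and a minimizer is a collision-free $T$-periodic solution which is not homographic.
   Context: Let $T>0$, $T^1=\mathbb{R}/T\mathbb{Z}$, $\mathcal{X}=\{x\in(\mathbb{R}^2)^4:\sum_im_ix_i=0\}$, $\Lambda=H^1(T^1,\mathcal{X})$. The generators act on time by $h_1t=-t$ and $h_2t=\frac TL-t$; $\rho\colon G\to O(2)$ is the action on the plane and $\sigma\colon G\to\Sigma_4$ the action on the indices (both homomorphisms, which restricts the admissible pairs $L$, angle between $l_1$ and $l_2$). $G$ acts on $\mathcal{X}$ by $(gx)_i=\rho(g)x_{\sigma(g)^{-1}(i)}$ and on $\Lambda$ by $(g\cdot x)(t)=g\,x(g^{-1}t)$; $\Lambda^G$ is the set of loops fixed by $G$. $\mathcal{A}(x)=\int_0^T\big(\sum_i\frac12m_i|\dot x_i|^2+\sum_{i<j}\frac{m_im_j}{|x_i-x_j|}\big)dt$, $\mathcal{A}^G=\mathcal{A}|_{\Lambda^G}$; coercive means $\mathcal{A}^G(x)\to\infty$ as the $H^1$-norm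 of $x\in\Lambda^G$ tends to infinity. A loop is collision-free if $x_i(t)\neq x_j(t)$ for all $t$ and $i\ne j$. A solution is a solution of Newton's equations. It is homographic if, identifying the plane with $\mathbb{C}$, $x(t)=s(t)x(0)$ for a $\mathbb{C}$-valued function $s$. *)

theory Defs
  imports
    "HOL-Analysis.Analysis"
    "HOL-Library.Real_Mod"
    "HOL-Algebra.Generated_Groups"
    "HOL-Algebra.Group_Action"
begin

text \<open>
  The plane is \<^typ>\<open>complex\<close> with its Euclidean structure, bodies are indexed by the four-element
  type \<^typ>\<open>4\<close> (in which \<^term>\<open>4 = (0::4)\<close>), and a configuration is an element of
  \<^typ>\<open>complex ^ 4\<close>. Loops on the circle of length \<open>T\<close> are \<open>T\<close>-periodic functions on the reals.
\<close>

subsection \<open>Configurations and symmetric loops\<close>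

definition mass :: "real \<Rightarrow> 4 \<Rightarrow> real" where
  "mass m i = (if i = 1 \<or> i = 2 then 1 else m)"

definition config_space :: "real \<Rightarrow> (complex ^ 4) set" where
  "config_space m = {x. (\<Sum>i\<in>UNIV. mass m i *\<^sub>R (x $ i)) = 0}"

text \<open>
  The function \<open>x\<close> is absolutely continuous on \<open>[0,T]\<close> with square-integrable derivative \<open>v\<close>;
  \<open>v\<close> is then determined by \<open>x\<close> almost everywhere on \<open>[0,T]\<close>.
\<close>
definition has_L2_derivative ::
    "real \<Rightarrow> (real \<Rightarrow> 'a::euclidean_space) \<Rightarrow> (real \<Rightarrow> 'a) \<Rightarrow> bool" where
  "has_L2_derivative T x v \<longleftrightarrow>
     set_borel_measurable lborel {0..T} v \<and>
     set_integrable lborel {0..T} (\<lambda>t. (norm (v t))\<^sup>2) \<and>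
     (\<forall>t\<in>{0..T}. x t = x 0 + (LINT s:{0..t}|lborel. v s))"

definition L2_derivative :: "real \<Rightarrow> (real \<Rightarrow> 'a::euclidean_space) \<Rightarrow> real \<Rightarrow> 'a" where
  "L2_derivative T x = (SOME v. has_L2_derivative T x v)"

text \<open>Elements of the Sobolev space are represented by their continuous representatives.\<close>
definition H1_loops :: "real \<Rightarrow> 'a::euclidean_space set \<Rightarrow> (real \<Rightarrow> 'a) set" where
  "H1_loops T X =
     {x. (\<forall>t. x (t + T) = x t) \<and> (\<forall>t. x t \<in> X) \<and> (\<exists>v. has_L2_derivative T x v)}"

definition H1_norm :: "real \<Rightarrow> (real \<Rightarrow> 'a::euclidean_space) \<Rightarrow> real" where
  "H1_norm T x =
     sqrt (LINT t:{0..T}|lborel. (norm (x t))\<^sup>2 + (norm (L2_derivative T x t))\<^sup>2)"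

definition config_act ::
    "('g \<Rightarrow> complex \<Rightarrow> complex) \<Rightarrow> ('g \<Rightarrow> 4 \<Rightarrow> 4) \<Rightarrow> 'g \<Rightarrow> complex ^ 4 \<Rightarrow> complex ^ 4" where
  "config_act \<rho> \<sigma> g x = (\<chi> i. \<rho> g (x $ (inv_into UNIV (\<sigma> g) i)))"

text \<open>
  The action \<open>\<tau>\<close> on the circle is given on the fundamental domain \<open>[0,T)\<close>.
\<close>
definition loop_act ::
    "('g, 'b) monoid_scheme \<Rightarrow> real \<Rightarrow> ('g \<Rightarrow> real \<Rightarrow> real) \<Rightarrow> ('g \<Rightarrow> complex \<Rightarrow> complex) \<Rightarrow>
     ('g \<Rightarrow> 4 \<Rightarrow> 4) \<Rightarrow> 'g \<Rightarrow> (real \<Rightarrow> complex ^ 4) \<Rightarrow> real \<Rightarrow> complex ^ 4" where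
  "loop_act G T \<tau> \<rho> \<sigma> g x t = config_act \<rho> \<sigma> g (x (\<tau> (inv\<^bsub>G\<^esub> g) (t rmod T)))"

definition symmetric_loops ::
    "('g, 'b) monoid_scheme \<Rightarrow> real \<Rightarrow> real \<Rightarrow> ('g \<Rightarrow> real \<Rightarrow> real) \<Rightarrow>
     ('g \<Rightarrow> complex \<Rightarrow> complex) \<Rightarrow> ('g \<Rightarrow> 4 \<Rightarrow> 4) \<Rightarrow> (real \<Rightarrow> complex ^ 4) set" where
  "symmetric_loops G T m \<tau> \<rho> \<sigma> =
     {x \<in> H1_loops T (config_space m). \<forall>g\<in>carrier G. loop_act G T \<tau> \<rho> \<sigma> g x = x}"

subsection \<open>The symmetry group\<close>

text \<open>
  A group of order \<open>2 L\<close> generated by \<open>h1\<close> and \<open>h2\<close> subject to these relations is the dihedral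
  group, as the group presented by the relations has order \<open>2 L\<close>. The condition \<open>0 < L\<close>
  matters because infinite groups have \<^const>\<open>order\<close> 0.
\<close>
definition dihedral :: "('g, 'b) monoid_scheme \<Rightarrow> nat \<Rightarrow> 'g \<Rightarrow> 'g \<Rightarrow> bool" where
  "dihedral G L h1 h2 \<longleftrightarrow>
     group G \<and> 0 < L \<and> order G = 2 * L \<and>
     h1 \<in> carrier G \<and> h2 \<in> carrier G \<and> generate G {h1, h2} = carrier G \<and>
     h1 \<otimes>\<^bsub>G\<^esub> h1 = \<one>\<^bsub>G\<^esub> \<and> h2 \<otimes>\<^bsub>G\<^esub> h2 = \<one>\<^bsub>G\<^esub> \<and>
     (h1 \<otimes>\<^bsub>G\<^esub> h2) [^]\<^bsub>G\<^esub> L = \<one>\<^bsub>G\<^esub>"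

text \<open>Reflection fixing the line spanned by \<open>e\<close> pointwise.\<close>
definition line_reflection :: "complex \<Rightarrow> complex \<Rightarrow> complex" where
  "line_reflection e z = (2 * (z \<bullet> e) / (e \<bullet> e)) *\<^sub>R e - z"

subsection \<open>The action functional\<close>

text \<open>
  The division is that of \<^typ>\<open>ennreal\<close>, so the potential is infinite at collisions.
\<close>
definition potential :: "real \<Rightarrow> complex ^ 4 \<Rightarrow> ennreal" where
  "potential m x =
     (\<Sum>i\<in>UNIV. \<Sum>j\<in>{i<..}. ennreal (mass m i * mass m j) / ennreal (norm (x $ i - x $ j)))"

definition kinetic :: "real \<Rightarrow> complex ^ 4 \<Rightarrow> real" where
  "kinetic m v = (\<Sum>i\<in>UNIV. 1 / 2 * mass m i * (norm (v $ i))\<^sup>2)"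

definition action :: "real \<Rightarrow> real \<Rightarrow> (real \<Rightarrow> complex ^ 4) \<Rightarrow> ennreal" where
  "action T m x =
     (\<integral>\<^sup>+t\<in>{0..T}. (ennreal (kinetic m (L2_derivative T x t)) + potential m (x t)) \<partial>lborel)"

definition coercive_on ::
    "real \<Rightarrow> (real \<Rightarrow> 'a::euclidean_space) set \<Rightarrow> ((real \<Rightarrow> 'a) \<Rightarrow> ennreal) \<Rightarrow> bool" where
  "coercive_on T S F \<longleftrightarrow> (\<forall>C::real. \<exists>R. \<forall>x\<in>S. H1_norm T x \<ge> R \<longrightarrow> F x \<ge> ennreal C)"

definition local_minimum_on ::
    "real \<Rightarrow> (real \<Rightarrow> 'a::euclidean_space) set \<Rightarrow> ((real \<Rightarrow> 'a) \<Rightarrow> ennreal) \<Rightarrow> (real \<Rightarrow> 'a) \<Rightarrow> bool"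
  where
  "local_minimum_on T S F x \<longleftrightarrow>
     x \<in> S \<and> (\<exists>\<epsilon>>0. \<forall>y\<in>S. H1_norm T (\<lambda>t. y t - x t) < \<epsilon> \<longrightarrow> F x \<le> F y)"

subsection \<open>Properties of loops\<close>

definition collision_free :: "(real \<Rightarrow> complex ^ 4) \<Rightarrow> bool" where
  "collision_free x \<longleftrightarrow> (\<forall>t i j. i \<noteq> j \<longrightarrow> x t $ i \<noteq> x t $ j)"

definition newton_solution :: "real \<Rightarrow> (real \<Rightarrow> complex ^ 4) \<Rightarrow> bool" where
  "newton_solution m x \<longleftrightarrow>
     (\<exists>v a. \<forall>t. (x has_vector_derivative v t) (at t) \<and> (v has_vector_derivative a t) (at t) \<and>
       (\<forall>i. mass m i *\<^sub>R (a t $ i) =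
          (\<Sum>j\<in>UNIV - {i}. (mass m i * mass m j / norm (x t $ j - x t $ i) ^ 3) *\<^sub>R
             (x t $ j - x t $ i))))"

definition homographic :: "(real \<Rightarrow> complex ^ 4) \<Rightarrow> bool" where
  "homographic x \<longleftrightarrow> (\<exists>s :: real \<Rightarrow> complex. \<forall>t i. x t $ i = s t * x 0 $ i)"

end

theory Submission
  imports Defs "HOL-Complex_Analysis.Great_Picard" "HOL-Library.Periodic_Fun"
begin

text \<open>
  A configuration fixed by both reflections vanishes, because the two lines are neither equal nor
  orthogonal. Hence a symmetric loop is bounded by its oscillation, so by the kinetic energy; this
  gives coercivity and, with lower semicontinuity of the action along uniformly convergent
  sequences of loops, a minimizer. If the action were infinite on all symmetric loops, the zero
  loop would be a minimum with collisions.

  Let \<open>x\<close> be a minimizer and \<open>q\<close> the periodic function with zero mean whose second derivative is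
  the Newtonian acceleration along \<open>x\<close>. Since the acceleration is equivariant, \<open>q\<close> is a symmetric
  loop, and the first variation in the single direction \<open>x - q\<close> shows that \<open>x - q\<close> is constant.
  This yields regularity and Newton's equations at once, without a separate principle of symmetric
  criticality.

  Finally, write the reflections as \<open>z \<mapsto> u1 * cnj z\<close> and \<open>z \<mapsto> u2 * cnj z\<close>. At time 0
  the first symmetry gives \<open>x1 = u1 * cnj x2\<close> and \<open>x3 = u1 * cnj x4\<close>. If \<open>x\<close> is homographic
  with factor \<open>s\<close> at time \<open>T / (2 * L)\<close>, the second symmetry of bodies 1 and 2 there gives
  \<open>s * u1 = u2 * cnj s\<close>, and that of bodies 3 and 4 then gives \<open>x3 = u1 * cnj x3\<close> and
  \<open>x4 = u1 * cnj x4\<close>, hence the collision \<open>x3 = x4\<close>.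
\<close>

section \<open>Square-integrable functions\<close>

text \<open>The position of the two lines enters twice through the absence of nonzero configurations
  fixed by both symmetries: it bounds a loop by its kinetic energy, and it forces the mean of the
  acceleration to vanish, without which the acceleration would have no periodic primitive.

  The action may be infinite, so it is never differentiated. Near a collision-free loop the
  potential has an explicit quadratic upper bound, and comparing x with x - \<epsilon> y gives a
  single inequality for the first variation. One inequality is enough: writing the acceleration as
  q'' and integrating by parts turns the variation into a pairing of the velocity of x - q with that
  of y, so y = x - q yields twice a kinetic energy, which cannot be negative.

  For existence, the two parts of the action need different arguments. The kinetic part is convex,
  so averaging controls it under uniform convergence; the potential part is not convex but is
  continuous with values in [0, infinity], so Fatou's lemma applies even if collisions appear in the
  limit.\<close>

lemma Cauchy_Schwarz_integral:
  fixes f g :: "'a \<Rightarrow> real"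
  assumes [measurable]: "f \<in> borel_measurable M" "g \<in> borel_measurable M"
    and f: "integrable M (\<lambda>x. (f x)\<^sup>2)" and g: "integrable M (\<lambda>x. (g x)\<^sup>2)"
  shows "integrable M (\<lambda>x. f x * g x)"
    and "(LINT x|M. f x * g x)\<^sup>2 \<le> (LINT x|M. (f x)\<^sup>2) * (LINT x|M. (g x)\<^sup>2)"
proof -
  have "\<bar>f x * g x\<bar> \<le> (f x)\<^sup>2 + (g x)\<^sup>2" for x
  proof -
    have "2 * \<bar>f x\<bar> * \<bar>g x\<bar> \<le> (f x)\<^sup>2 + (g x)\<^sup>2"
      using sum_squares_bound[of "\<bar>f x\<bar>" "\<bar>g x\<bar>"] by simp
    moreover have "0 \<le> \<bar>f x\<bar> * \<bar>g x\<bar>"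
      by simp
    ultimately show ?thesis
      unfolding abs_mult by linarith
  qed
  then show fg: "integrable M (\<lambda>x. f x * g x)"
    by (intro Bochner_Integration.integrable_bound[OF Bochner_Integration.integrable_add[OF f g]]) auto
  let ?a = "LINT x|M. (g x)\<^sup>2" and ?b = "LINT x|M. f x * g x" and ?c = "LINT x|M. (f x)\<^sup>2"
  have quad: "0 \<le> ?c - 2 * s * ?b + s\<^sup>2 * ?a" for s
  proof -
    have "0 \<le> (LINT x|M. (f x - s * g x)\<^sup>2)"
      by simp
    also have "\<dots> = (LINT x|M. (f x)\<^sup>2 - 2 * s * (f x * g x) + s\<^sup>2 * (g x)\<^sup>2)"
      by (intro Bochner_Integration.integral_cong) (auto simp: power2_eq_square algebra_simps)
    also have "\<dots> = ?c - 2 * s * ?b + s\<^sup>2 * ?a"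
      using f g fg by simp
    finally show ?thesis .
  qed
  show "?b\<^sup>2 \<le> ?c * ?a"
  proof (cases "?a = 0")
    case True
    then have "AE x in M. (g x)\<^sup>2 = 0"
      using g integral_nonneg_eq_0_iff_AE[of M "\<lambda>x. (g x)\<^sup>2"] by simp
    then have "?b = 0"
      by (intro integral_eq_zero_AE) auto
    then show ?thesis
      using True by simp
  next
    case False
    then have a: "?a > 0"
      by (simp add: order_less_le)
    \<comment> \<open>The quadratic is smallest at its vertex s = ?b / ?a, which gives the sharpest
      inequality.\<close>
    have "0 \<le> (?c - 2 * (?b / ?a) * ?b + (?b / ?a)\<^sup>2 * ?a) * ?a"
      using quad[of "?b / ?a"] a by (intro mult_nonneg_nonneg) auto
    also have "\<dots> = ?c * ?a - ?b\<^sup>2"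
      using a by (simp add: field_simps power2_eq_square)
    finally show ?thesis
      by simp
  qed
qed

lemma norm_add_squared_le:
  fixes a b :: "'a :: real_normed_vector"
  shows "(norm (a + b))\<^sup>2 \<le> 2 * (norm a)\<^sup>2 + 2 * (norm b)\<^sup>2"
proof -
  have "(norm (a + b))\<^sup>2 \<le> (norm a + norm b)\<^sup>2"
    by (intro power_mono norm_triangle_ineq) auto
  also have "\<dots> \<le> 2 * (norm a)\<^sup>2 + 2 * (norm b)\<^sup>2"
    using sum_squares_bound[of "norm a" "norm b"] by (simp add: power2_sum)
  finally show ?thesis .
qed

lemma square_integrable_add:
  fixes f g :: "'a \<Rightarrow> 'b::euclidean_space"
  assumes [measurable]: "f \<in> borel_measurable M" "g \<in> borel_measurable M"
    and f: "integrable M (\<lambda>x. (norm (f x))\<^sup>2)" and g: "integrable M (\<lambda>x. (norm (g x))\<^sup>2)"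
  shows "integrable M (\<lambda>x. (norm (f x + g x))\<^sup>2)"
  using norm_add_squared_le
  by (intro Bochner_Integration.integrable_bound[OF Bochner_Integration.integrable_add[OF
        integrable_mult_right[OF f, of 2] integrable_mult_right[OF g, of 2]]]) auto

lemma square_integrable_scaleR:
  fixes f :: "'a \<Rightarrow> 'b::euclidean_space"
  assumes "integrable M (\<lambda>x. (norm (f x))\<^sup>2)"
  shows "integrable M (\<lambda>x. (norm (c *\<^sub>R f x))\<^sup>2)"
  using integrable_mult_right[OF assms, of "c\<^sup>2"] by (simp add: power_mult_distrib)

lemma square_integrable_diff:
  fixes f g :: "'a \<Rightarrow> 'b::euclidean_space"
  assumes "f \<in> borel_measurable M" "g \<in> borel_measurable M"
    and "integrable M (\<lambda>x. (norm (f x))\<^sup>2)" "integrable M (\<lambda>x. (norm (g x))\<^sup>2)"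
  shows "integrable M (\<lambda>x. (norm (f x - g x))\<^sup>2)"
  using square_integrable_add[of f M "\<lambda>x. - g x"] assms by simp

lemma square_integrable_inner:
  fixes f g :: "'a \<Rightarrow> 'b::euclidean_space"
  assumes [measurable]: "f \<in> borel_measurable M" "g \<in> borel_measurable M"
    and f: "integrable M (\<lambda>x. (norm (f x))\<^sup>2)" and g: "integrable M (\<lambda>x. (norm (g x))\<^sup>2)"
  shows "integrable M (\<lambda>x. f x \<bullet> g x)"
proof -
  have "integrable M (\<lambda>x. norm (f x) * norm (g x))"
    using f g by (intro Cauchy_Schwarz_integral) auto
  then show ?thesis
    by (rule Bochner_Integration.integrable_bound) (auto intro!: Cauchy_Schwarz_ineq2)
qed

context finite_measure
begin

text \<open>Pairing \<open>norm (f x)\<close> with the indicator of A in the Cauchy-Schwarz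
  inequality produces the factor \<open>sqrt (measure M A)\<close>. For an interval A this factor
  becomes the modulus of continuity of loops.\<close>

lemma L1_le_L2:
  fixes f :: "'a \<Rightarrow> 'b::euclidean_space"
  assumes [measurable]: "f \<in> borel_measurable M" and f: "integrable M (\<lambda>x. (norm (f x))\<^sup>2)"
  shows "integrable M f"
    and "A \<in> sets M \<Longrightarrow>
      (LINT x:A|M. norm (f x)) \<le> sqrt (measure M A) * sqrt (LINT x|M. (norm (f x))\<^sup>2)"
proof -
  have "integrable M (\<lambda>x. norm (f x))"
    using Cauchy_Schwarz_integral(1)[of "\<lambda>x. norm (f x)" M "\<lambda>x. 1"] f by simp
  then show "integrable M f"
    by (subst (asm) integrable_norm_iff) auto
  assume A[measurable]: "A \<in> sets M"
  have "(LINT x|M. norm (f x) * indicator A x)\<^sup>2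
        \<le> (LINT x|M. (norm (f x))\<^sup>2) * (LINT x|M. (indicator A x)\<^sup>2)"
    using f integrable_real_indicator[of A M]
    by (intro Cauchy_Schwarz_integral(2))
      (auto simp: power2_eq_square simp flip: indicator_inter_arith less_top)
  also have "(LINT x|M. (indicator A x :: real)\<^sup>2) = (LINT x|M. indicator A x)"
    by (intro Bochner_Integration.integral_cong) (auto simp: indicator_def)
  also have "\<dots> = measure M A"
    by simp
  finally have "\<bar>LINT x|M. norm (f x) * indicator A x\<bar>
      \<le> sqrt ((LINT x|M. (norm (f x))\<^sup>2) * measure M A)"
    by (simp add: real_le_rsqrt)
  then show "(LINT x:A|M. norm (f x)) \<le> sqrt (measure M A) * sqrt (LINT x|M. (norm (f x))\<^sup>2)"
    by (simp add: set_lebesgue_integral_def real_sqrt_mult mult.commute)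
qed

lemma norm_set_integral_le_L2:
  fixes f :: "'a \<Rightarrow> 'b::euclidean_space"
  assumes "f \<in> borel_measurable M" "integrable M (\<lambda>x. (norm (f x))\<^sup>2)" "A \<in> sets M"
  shows "norm (LINT x:A|M. f x) \<le> sqrt (measure M A) * sqrt (LINT x|M. (norm (f x))\<^sup>2)"
proof -
  have "norm (LINT x:A|M. f x) \<le> (LINT x:A|M. norm (f x))"
    unfolding set_lebesgue_integral_def
    by (rule order_trans[OF integral_norm_bound]) simp
  then show ?thesis
    using L1_le_L2(2)[OF assms] by simp
qed

text \<open>Riesz-Fischer on a finite measure space: an L2-Cauchy sequence is L1-Cauchy there, so a
  subsequence converges almost everywhere, and Fatou's lemma upgrades the pointwise limit to an L2
  limit. The last conclusion lets an energy bound pass to the limit.\<close>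

lemma L2_complete:
  fixes f :: "nat \<Rightarrow> 'a \<Rightarrow> 'b::euclidean_space"
  assumes [measurable]: "\<And>n. f n \<in> borel_measurable M"
    and f: "\<And>n. integrable M (\<lambda>x. (norm (f n x))\<^sup>2)"
    and Cauchy: "\<And>e. e > 0 \<Longrightarrow> \<exists>N. \<forall>i\<ge>N. \<forall>j\<ge>N. (LINT x|M. (norm (f i x - f j x))\<^sup>2) < e"
  obtains g where "g \<in> borel_measurable M" "integrable M (\<lambda>x. (norm (g x))\<^sup>2)"
    "(\<lambda>n. LINT x|M. (norm (f n x - g x))\<^sup>2) \<longlonglongrightarrow> 0"
    "\<And>B. (\<And>n. (LINT x|M. (norm (f n x))\<^sup>2) \<le> B) \<Longrightarrow> (LINT x|M. (norm (g x))\<^sup>2) \<le> B"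
proof -
  have diff: "integrable M (\<lambda>x. (norm (f i x - f j x))\<^sup>2)" for i j
    by (intro square_integrable_diff f) auto
  have "\<exists>N. \<forall>i\<ge>N. \<forall>j\<ge>N. (LINT x|M. norm (f i x - f j x)) < e" if "e > 0" for e
  proof -
    \<comment> \<open>The summand 1 keeps c positive even on a null space, so dividing by c is
      safe.\<close>
    define c where "c = sqrt (measure M (space M)) + 1"
    have c: "c > 0" "c > sqrt (measure M (space M))"
      by (auto simp: c_def add_nonneg_pos)
    obtain N where N: "\<forall>i\<ge>N. \<forall>j\<ge>N. (LINT x|M. (norm (f i x - f j x))\<^sup>2) < (e / c)\<^sup>2"
      using Cauchy[of "(e / c)\<^sup>2"] \<open>e > 0\<close> c by auto
    have "(LINT x|M. norm (f i x - f j x)) < e" if "i \<ge> N" "j \<ge> N" for i j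
    proof -
      let ?I = "LINT x|M. (norm (f i x - f j x))\<^sup>2"
      have "sqrt ?I < sqrt ((e / c)\<^sup>2)"
        using N that real_sqrt_less_mono by blast
      then have I: "sqrt ?I < e / c"
        using \<open>e > 0\<close> c by simp
      have "(LINT x|M. norm (f i x - f j x)) = (LINT x:space M|M. norm (f i x - f j x))"
        by (simp add: set_integral_space L1_le_L2 diff)
      also have "\<dots> \<le> sqrt (measure M (space M)) * sqrt ?I"
        by (intro L1_le_L2(2) diff) auto
      also have "\<dots> \<le> c * sqrt ?I"
        using c by (intro mult_right_mono) auto
      also have "\<dots> < e"
        using I c by (simp add: field_simps)
      finally show ?thesis .
    qed
    then show ?thesis
      by blast
  qed
  then obtain r where r: "strict_mono r" "AE x in M. Cauchy (\<lambda>i. f (r i) x)"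
    using cauchy_L1_AE_cauchy_subseq[of M f] L1_le_L2(1)[OF _ f] by (metis assms(1))
  define g where "g = (\<lambda>x. lim (\<lambda>i. f (r i) x))"
  have [measurable]: "g \<in> borel_measurable M"
    unfolding g_def by measurable
  have lim: "AE x in M. (\<lambda>i. f (r i) x) \<longlonglongrightarrow> g x"
    using r(2) by eventually_elim (simp add: g_def Cauchy_convergent_iff convergent_LIMSEQ_iff)
  \<comment> \<open>A general h serves two purposes: h = f n gives convergence, h = 0 gives the norm
    bound.\<close>
  have fatou: "(\<integral>\<^sup>+x. ennreal ((norm (h x - g x))\<^sup>2) \<partial>M) \<le> ennreal B"
    if [measurable]: "h \<in> borel_measurable M" and h: "integrable M (\<lambda>x. (norm (h x))\<^sup>2)"
      and B: "\<And>i. i \<ge> N \<Longrightarrow> (LINT x|M. (norm (h x - f i x))\<^sup>2) \<le> B" for h B N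
  proof -
    have int: "integrable M (\<lambda>x. (norm (h x - f i x))\<^sup>2)" for i
      by (intro square_integrable_diff f h) auto
    have "(\<integral>\<^sup>+x. ennreal ((norm (h x - g x))\<^sup>2) \<partial>M)
        = (\<integral>\<^sup>+x. liminf (\<lambda>i. ennreal ((norm (h x - f (r i) x))\<^sup>2)) \<partial>M)"
    proof (intro nn_integral_cong_AE, use lim in eventually_elim)
      case (elim x)
      then have "(\<lambda>i. ennreal ((norm (h x - f (r i) x))\<^sup>2)) \<longlonglongrightarrow> ennreal ((norm (h x - g x))\<^sup>2)"
        by (intro tendsto_intros)
      then show ?case
        using lim_imp_Liminf trivial_limit_sequentially by metis
    qed
    also have "\<dots> \<le> liminf (\<lambda>i. \<integral>\<^sup>+x. ennreal ((norm (h x - f (r i) x))\<^sup>2) \<partial>M)"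
      by (intro nn_integral_liminf) auto
    also have "\<dots> \<le> ennreal B"
    proof (rule Liminf_le)
      have "ennreal (LINT x|M. (norm (h x - f (r i) x))\<^sup>2) \<le> ennreal B" if "i \<ge> N" for i
        using that seq_suble[OF r(1), of i] by (intro ennreal_leI B) auto
      then show "\<forall>\<^sub>F i in sequentially. (\<integral>\<^sup>+x. ennreal ((norm (h x - f (r i) x))\<^sup>2) \<partial>M) \<le> ennreal B"
        unfolding eventually_sequentially
        by (intro exI[of _ N]) (simp add: nn_integral_eq_integral[OF int])
    qed simp
    finally show ?thesis .
  qed
  have close: "\<exists>N. \<forall>n\<ge>N. integrable M (\<lambda>x. (norm (f n x - g x))\<^sup>2) \<and>
        (LINT x|M. (norm (f n x - g x))\<^sup>2) \<le> e" if "e > 0" for e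
  proof -
    obtain N where N: "\<forall>i\<ge>N. \<forall>j\<ge>N. (LINT x|M. (norm (f i x - f j x))\<^sup>2) < e"
      using Cauchy[OF \<open>e > 0\<close>] by blast
    have "integrable M (\<lambda>x. (norm (f n x - g x))\<^sup>2) \<and> (LINT x|M. (norm (f n x - g x))\<^sup>2) \<le> e"
      if "n \<ge> N" for n
    proof -
      have le: "(\<integral>\<^sup>+x. ennreal ((norm (f n x - g x))\<^sup>2) \<partial>M) \<le> ennreal e"
        using N that by (intro fatou[of _ N] f) (auto intro: less_imp_le)
      then have int: "integrable M (\<lambda>x. (norm (f n x - g x))\<^sup>2)"
        by (intro integrableI_nonneg) (auto intro: le_less_trans)
      then show ?thesis
        using le \<open>e > 0\<close> by (simp add: nn_integral_eq_integral)
    qed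
    then show ?thesis
      by blast
  qed
  obtain N where N: "integrable M (\<lambda>x. (norm (f N x - g x))\<^sup>2)"
    using close[of 1] by auto
  have g: "integrable M (\<lambda>x. (norm (g x))\<^sup>2)"
    using square_integrable_diff[of "f N" M "\<lambda>x. f N x - g x"] N f by simp
  show thesis
  proof (rule that[of g])
    show "(\<lambda>n. LINT x|M. (norm (f n x - g x))\<^sup>2) \<longlonglongrightarrow> 0"
    proof (rule LIMSEQ_I)
      fix e :: real assume "e > 0"
      then obtain N where "\<forall>n\<ge>N. (LINT x|M. (norm (f n x - g x))\<^sup>2) \<le> e / 2"
        using close[of "e / 2"] by auto
      then show "\<exists>N. \<forall>n\<ge>N. norm ((LINT x|M. (norm (f n x - g x))\<^sup>2) - 0) < e"
        using \<open>e > 0\<close> by (intro exI[of _ N]) (auto intro: le_less_trans[of _ "e / 2"])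
    qed
    fix B assume B: "\<And>n. (LINT x|M. (norm (f n x))\<^sup>2) \<le> B"
    have "0 \<le> B"
      using B[of 0] by (rule order_trans[rotated]) simp
    moreover have "(\<integral>\<^sup>+x. ennreal ((norm (g x))\<^sup>2) \<partial>M) \<le> ennreal B"
      using fatou[of "\<lambda>_. 0" 0 B] B by simp
    ultimately show "(LINT x|M. (norm (g x))\<^sup>2) \<le> B"
      using g by (simp add: nn_integral_eq_integral)
  qed (use g in auto)
qed

end

section \<open>Functions with square-integrable derivative\<close>

text \<open>The statement of the theorem uses set integrals over \<open>lborel\<close>. Restricting
  the measure once turns them into plain integrals over a finite measure, where
  \<open>L1_le_L2\<close> and \<open>L2_complete\<close> are available.\<close>

abbreviation period_measure :: "real \<Rightarrow> real measure" where
  "period_measure T \<equiv> restrict_space lborel {0..T}"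

interpretation period_measure: finite_measure "period_measure T" for T
  by (rule finite_measureI)
    (simp add: space_restrict_space emeasure_restrict_space emeasure_lborel_Icc_eq)

lemma measure_period_measure:
  assumes "s \<in> {0..T}" "t \<in> {0..T}" "s \<le> t"
  shows "measure (period_measure T) {s..t} = t - s"
  using assms by (subst measure_restrict_space) auto

lemma borel_measurable_period_measure_iff:
  fixes v :: "real \<Rightarrow> 'a::euclidean_space"
  shows "v \<in> borel_measurable (period_measure T) \<longleftrightarrow> set_borel_measurable lborel {0..T} v"
  by (simp add: set_borel_measurable_def borel_measurable_restrict_space_iff)

lemma integrable_period_measure_iff:
  fixes v :: "real \<Rightarrow> 'a::{banach, second_countable_topology}"
  shows "integrable (period_measure T) v \<longleftrightarrow> set_integrable lborel {0..T} v"
  by (simp add: set_integrable_def integrable_restrict_space)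

lemma set_integral_period_measure:
  fixes v :: "real \<Rightarrow> 'a::{banach, second_countable_topology}"
  assumes "A \<subseteq> {0..T}"
  shows "(LINT s:A|period_measure T. v s) = (LINT s:A|lborel. v s)"
proof -
  have "indicator A s *\<^sub>R indicator {0..T} s *\<^sub>R v s = indicator A s *\<^sub>R v s" for s
    using assms by (auto simp: indicator_def)
  then have "(LINT s|lborel. indicator A s *\<^sub>R indicator {0..T} s *\<^sub>R v s)
      = (LINT s|lborel. indicator A s *\<^sub>R v s)"
    by presburger
  then show ?thesis
    using set_integral_restrict_space[of "{0..T}" lborel A v] by (simp add: set_lebesgue_integral_def)
qed

lemma integral_period_measure:
  fixes v :: "real \<Rightarrow> 'a::{banach, second_countable_topology}"
  shows "(LINT s|period_measure T. v s) = (LINT s:{0..T}|lborel. v s)"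
  by (simp add: set_lebesgue_integral_def integral_restrict_space)

lemma continuous_measurable_period_measure:
  fixes f :: "real \<Rightarrow> 'a::euclidean_space"
  assumes "continuous_on {0..T} f"
  shows "f \<in> borel_measurable (period_measure T)"
  using borel_measurable_continuous_on_indicator[OF _ assms]
  by (simp add: borel_measurable_period_measure_iff set_borel_measurable_def)

lemma continuous_integrable_period_measure:
  fixes f :: "real \<Rightarrow> 'a::euclidean_space"
  assumes "continuous_on {0..T} f"
  shows "integrable (period_measure T) f"
  using borel_integrable_compact[OF _ assms]
  by (simp add: integrable_period_measure_iff set_integrable_def)

lemma has_L2_derivative_iff:
  "has_L2_derivative T x v \<longleftrightarrow>
     v \<in> borel_measurable (period_measure T) \<and>
     integrable (period_measure T) (\<lambda>t. (norm (v t))\<^sup>2) \<and>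
     (\<forall>t\<in>{0..T}. x t = x 0 + (LINT s:{0..t}|period_measure T. v s))"
proof -
  have "(LINT s:{0..t}|period_measure T. v s) = (LINT s:{0..t}|lborel. v s)" if "t \<in> {0..T}" for t
    using that by (intro set_integral_period_measure) auto
  then show ?thesis
    unfolding has_L2_derivative_def borel_measurable_period_measure_iff
      integrable_period_measure_iff by auto
qed

context
  fixes T :: real and x v :: "real \<Rightarrow> 'a::euclidean_space"
  assumes v: "has_L2_derivative T x v"
begin

lemma has_L2_derivative_measurable: "v \<in> borel_measurable (period_measure T)"
  and has_L2_derivative_square_integrable: "integrable (period_measure T) (\<lambda>t. (norm (v t))\<^sup>2)"
  and has_L2_derivative_integral:
    "t \<in> {0..T} \<Longrightarrow> x t = x 0 + (LINT s:{0..t}|period_measure T. v s)"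
  using v unfolding has_L2_derivative_iff by blast+

lemma has_L2_derivative_integrable: "integrable (period_measure T) v"
  using has_L2_derivative_measurable has_L2_derivative_square_integrable
  by (rule period_measure.L1_le_L2)

lemma has_L2_derivative_diff_eq_integral:
  assumes "s \<in> {0..T}" "t \<in> {0..T}" "s \<le> t"
  shows "x t - x s = (LINT r:{s<..t}|period_measure T. v r)"
proof -
  have "(LINT r:{0..s} \<union> {s<..t}|period_measure T. v r)
      = (LINT r:{0..s}|period_measure T. v r) + (LINT r:{s<..t}|period_measure T. v r)"
    using assms unfolding set_integrable_def
    by (intro set_integral_Un) (auto simp: set_integrable_def sets_restrict_space_iff
        intro!: integrable_mult_indicator has_L2_derivative_integrable)
  moreover have "{0..s} \<union> {s<..t} = {0..t}"
    using assms by auto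
  ultimately show ?thesis
    using assms has_L2_derivative_integral[of s] has_L2_derivative_integral[of t] by simp
qed

text \<open>Cauchy-Schwarz on the interval between s and t gives Holder exponent one half. The
  constant depends on the energy alone, so loops of bounded energy are equicontinuous.\<close>

lemma has_L2_derivative_Holder:
  assumes "s \<in> {0..T}" "t \<in> {0..T}"
  shows "norm (x t - x s) \<le> sqrt \<bar>t - s\<bar> * sqrt (LINT t|period_measure T. (norm (v t))\<^sup>2)"
proof -
  have *: "norm (x t - x s) \<le> sqrt (t - s) * sqrt (LINT t|period_measure T. (norm (v t))\<^sup>2)"
    if "s \<in> {0..T}" "t \<in> {0..T}" "s \<le> t" for s t
  proof -
    have "{s<..t} \<in> sets (period_measure T)"
      using that by (auto simp: sets_restrict_space_iff)
    moreover have "measure (period_measure T) {s<..t} = t - s"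
      using that by (subst measure_restrict_space) auto
    ultimately show ?thesis
      using period_measure.norm_set_integral_le_L2[of v T "{s<..t}"] that
        has_L2_derivative_measurable has_L2_derivative_square_integrable
      by (simp add: has_L2_derivative_diff_eq_integral)
  qed
  show ?thesis
    using *[of s t] *[of t s] assms by (cases "s \<le> t") (auto simp: norm_minus_commute)
qed

lemma has_L2_derivative_continuous_on: "continuous_on {0..T} x"
  unfolding continuous_on_def
proof
  fix s assume s: "s \<in> {0..T}"
  let ?c = "sqrt (LINT t|period_measure T. (norm (v t))\<^sup>2)"
  have "((\<lambda>t. sqrt \<bar>t - s\<bar> * ?c) \<longlongrightarrow> sqrt \<bar>s - s\<bar> * ?c) (at s within {0..T})"
    by (intro tendsto_intros)
  then have "((\<lambda>t. x t - x s) \<longlongrightarrow> 0) (at s within {0..T})"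
    using has_L2_derivative_Holder[OF s]
    by (intro Lim_null_comparison[of "\<lambda>t. x t - x s" "\<lambda>t. sqrt \<bar>t - s\<bar> * ?c"])
      (auto simp: eventually_at_filter)
  then show "(x \<longlongrightarrow> x s) (at s within {0..T})"
    by (rule LIM_zero_cancel)
qed

end

lemma has_L2_derivative_add:
  assumes "has_L2_derivative T x v" "has_L2_derivative T y w"
  shows "has_L2_derivative T (\<lambda>t. x t + y t) (\<lambda>t. v t + w t)"
proof -
  have "(LINT s:{0..t}|period_measure T. v s + w s) =
      (LINT s:{0..t}|period_measure T. v s) + (LINT s:{0..t}|period_measure T. w s)"
    if "t \<in> {0..T}" for t
    using that unfolding set_integrable_def
    by (intro set_integral_add) (auto simp: set_integrable_def sets_restrict_space_iff
        intro!: integrable_mult_indicator assms[THEN has_L2_derivative_integrable])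
  then have "x t + y t = x 0 + y 0 + (LINT s:{0..t}|period_measure T. v s + w s)" if "t \<in> {0..T}" for t
    using has_L2_derivative_integral[OF assms(1) that] has_L2_derivative_integral[OF assms(2) that] that
    by simp
  moreover note assms[THEN has_L2_derivative_measurable]
    assms[THEN has_L2_derivative_square_integrable]
  ultimately show ?thesis
    unfolding has_L2_derivative_iff by (intro conjI ballI square_integrable_add borel_measurable_add)
qed

lemma has_L2_derivative_linear:
  fixes A :: "'a::euclidean_space \<Rightarrow> 'b::euclidean_space"
  assumes A: "linear A" and v: "has_L2_derivative T x v"
  shows "has_L2_derivative T (\<lambda>t. A (x t)) (\<lambda>t. A (v t))"
proof -
  have bl: "bounded_linear A"
    using A by (rule linear_conv_bounded_linear[THEN iffD1])
  have Av: "(\<lambda>t. A (v t)) \<in> borel_measurable (period_measure T)"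
    using has_L2_derivative_measurable[OF v] linear_continuous_on[OF bl, of UNIV]
    by (rule measurable_compose[OF _ borel_measurable_continuous_onI])
  obtain K where K: "\<And>a. norm (A a) \<le> norm a * K"
    using bounded_linear.nonneg_bounded[OF bl] by blast
  have "(norm (A (v t)))\<^sup>2 \<le> K\<^sup>2 * (norm (v t))\<^sup>2" for t
    using power_mono[OF K, of "v t" 2] by (simp add: power_mult_distrib mult.commute)
  then have "norm ((norm (A (v t)))\<^sup>2) \<le> norm (K\<^sup>2 * (norm (v t))\<^sup>2)" for t
    unfolding real_norm_def by (metis abs_of_nonneg order_trans zero_le_power2)
  then have "integrable (period_measure T) (\<lambda>t. (norm (A (v t)))\<^sup>2)"
    using Av by (intro Bochner_Integration.integrable_bound[OF
          integrable_mult_right[OF has_L2_derivative_square_integrable[OF v], of "K\<^sup>2"]] AE_I2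
          borel_measurable_power measurable_compose[OF _ borel_measurable_norm])
  moreover have "A (x t) = A (x 0) + (LINT s:{0..t}|period_measure T. A (v s))"
    if "t \<in> {0..T}" for t
  proof -
    have "(LINT s:{0..t}|period_measure T. A (v s)) = A (LINT s:{0..t}|period_measure T. v s)"
      using that unfolding set_lebesgue_integral_def linear_cmul[OF A, symmetric]
      by (intro integral_bounded_linear[OF bl] integrable_mult_indicator
          has_L2_derivative_integrable[OF v]) (auto simp: sets_restrict_space_iff)
    then show ?thesis
      using has_L2_derivative_integral[OF v that] by (simp add: linear_add[OF A])
  qed
  ultimately show ?thesis
    unfolding has_L2_derivative_iff by (intro conjI ballI Av)
qed

lemma has_L2_derivative_scaleR:
  "has_L2_derivative T x v \<Longrightarrow> has_L2_derivative T (\<lambda>t. c *\<^sub>R x t) (\<lambda>t. c *\<^sub>R v t)"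
  by (rule has_L2_derivative_linear[OF linear_scaleR])

lemma has_L2_derivative_diff:
  assumes x: "has_L2_derivative T x v" and y: "has_L2_derivative T y w"
  shows "has_L2_derivative T (\<lambda>t. x t - y t) (\<lambda>t. v t - w t)"
  using has_L2_derivative_add[OF x has_L2_derivative_scaleR[OF y, of "-1"]] by simp

text \<open>The difference of two derivatives integrates to zero over every initial interval.
  Initial intervals are closed under intersection and generate the Borel sets of the period, so by
  Dynkin induction all its integrals vanish and it is zero almost everywhere.\<close>

lemma has_L2_derivative_unique:
  assumes v: "has_L2_derivative T x v" and w: "has_L2_derivative T x w"
  shows "AE t in period_measure T. v t = w t"
proof -
  define d where "d = (\<lambda>t. v t - w t)"
  have d: "has_L2_derivative T (\<lambda>t. 0) d"
    using has_L2_derivative_diff[OF v w] unfolding d_def diff_self .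
  have int: "integrable (period_measure T) d"
    using d by (rule has_L2_derivative_integrable)
  then have seti: "set_integrable (period_measure T) A d" if "A \<in> sets (period_measure T)" for A
    using that by (auto simp: set_integrable_def intro: integrable_mult_indicator)
  let ?G = "insert {} ((\<lambda>t. {0..t}) ` {0..T})"
  have sub: "?G \<subseteq> sets (period_measure T)"
    by (auto simp: sets_restrict_space_iff)
  have sig: "sets (period_measure T) = sigma_sets {0..T} ?G"
  proof
    show "sigma_sets {0..T} ?G \<subseteq> sets (period_measure T)"
      using sub sets.sigma_sets_subset[of ?G "period_measure T"] by (simp add: space_restrict_space)
    have gen: "{0..T} \<inter> {..a} \<in> sigma_sets {0..T} ?G" for a
    proof -
      have "{0..T} \<inter> {..a} = (if a < 0 then {} else {0..min a T})"
        by auto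
      also have "\<dots> \<in> ?G \<or> \<dots> = {}"
        by (cases "T < 0") auto
      finally show ?thesis
        by (auto intro: sigma_sets.Basic sigma_sets.Empty)
    qed
    have borel: "sets (borel :: real measure) = sigma_sets UNIV (range (\<lambda>a. {..a}))"
      by (simp add: borel_eq_atMost)
    then have "sets (period_measure T) = (\<inter>) {0..T} ` sigma_sets UNIV (range (\<lambda>a::real. {..a}))"
      by (simp add: sets_restrict_space)
    also have "\<dots> = sigma_sets {0..T} ((\<inter>) {0..T} ` range (\<lambda>a::real. {..a}))"
      using atLeastAtMost_borel[of 0 T] unfolding borel by (intro sigma_sets_Int) simp_all
    also have "\<dots> \<subseteq> sigma_sets {0..T} ?G"
      using gen by (intro sigma_sets_mono) auto
    finally show "sets (period_measure T) \<subseteq> sigma_sets {0..T} ?G" .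
  qed
  have "set_lebesgue_integral (period_measure T) A d = 0" if "A \<in> sets (period_measure T)" for A
  proof (rule sigma_sets_induct_disjoint[of ?G "{0..T}" A])
    show "Int_stable ?G"
      by (auto simp: Int_stable_def)
    show "A \<in> sigma_sets {0..T} ?G"
      using that sig by simp
    fix B assume "B \<in> ?G"
    then show "set_lebesgue_integral (period_measure T) B d = 0"
      using has_L2_derivative_integral[OF d] by (auto simp: set_lebesgue_integral_def)
  next
    fix B assume B: "B \<in> sigma_sets {0..T} ?G" "set_lebesgue_integral (period_measure T) B d = 0"
    have "set_lebesgue_integral (period_measure T) {0..T} d = 0"
      using has_L2_derivative_integral[OF d, of T]
      by (cases "T < 0") (auto simp: set_lebesgue_integral_def)
    moreover have "{0..T} = B \<union> ({0..T} - B)"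
      using B(1) sig sets.sets_into_space[of B "period_measure T"] by (auto simp: space_restrict_space)
    moreover have "set_lebesgue_integral (period_measure T) (B \<union> ({0..T} - B)) d
       = set_lebesgue_integral (period_measure T) B d
       + set_lebesgue_integral (period_measure T) ({0..T} - B) d"
      using B(1) sig sets.compl_sets[of B "period_measure T"]
      by (intro set_integral_Un seti) (auto simp: space_restrict_space)
    ultimately show "set_lebesgue_integral (period_measure T) ({0..T} - B) d = 0"
      using B(2) by simp
  next
    fix B :: "nat \<Rightarrow> real set"
    assume B: "disjoint_family B" "range B \<subseteq> sigma_sets {0..T} ?G"
      "\<And>i. set_lebesgue_integral (period_measure T) (B i) d = 0"
    have "set_lebesgue_integral (period_measure T) (\<Union>i. B i) d
        = (\<Sum>i. set_lebesgue_integral (period_measure T) (B i) d)"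
      using B sig by (intro lebesgue_integral_countable_add seti sets.countable_UN)
        (auto simp: disjoint_family_on_def)
    then show "set_lebesgue_integral (period_measure T) (\<Union>i. B i) d = 0"
      using B(3) by simp
  qed (auto simp: set_lebesgue_integral_def)
  then have "AE t in period_measure T. d t = 0"
    using period_measure.density_zero[OF int] by blast
  then show ?thesis
    by (simp add: d_def)
qed

text \<open>The arbitrary choice in \<open>L2_derivative\<close> is harmless: action and norm can be
  computed with any derivative at hand.\<close>

lemma L2_derivative:
  assumes "has_L2_derivative T x v"
  shows "has_L2_derivative T x (L2_derivative T x)"
    and "AE t in period_measure T. L2_derivative T x t = v t"
proof -
  show *: "has_L2_derivative T x (L2_derivative T x)"
    unfolding L2_derivative_def using assms by (rule someI[of "has_L2_derivative T x"])
  show "AE t in period_measure T. L2_derivative T x t = v t"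
    using * assms by (rule has_L2_derivative_unique)
qed

text \<open>
  This replaces weak compactness in \<open>L\<^sup>2\<close>. The derivatives \<open>w\<close> of functions uniformly
  \<open>1 / n\<close>-close to \<open>x\<close> form convex sets shrinking with \<open>n\<close>. By the parallelogram law, nearly
  norm-minimizing elements of these sets are a Cauchy sequence, and its limit is the derivative
  of \<open>x\<close>.
\<close>

lemma L2_derivative_lower_semicontinuous:
  fixes x :: "real \<Rightarrow> 'a::euclidean_space"
  assumes deriv: "\<And>n::nat. has_L2_derivative T (xs n) (vs n)"
    and bound: "\<And>n. (LINT t|period_measure T. (norm (vs n t))\<^sup>2) \<le> B"
    and lim: "uniform_limit {0..T} xs x sequentially"
  obtains v where "has_L2_derivative T x v" "(LINT t|period_measure T. (norm (v t))\<^sup>2) \<le> B"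
proof -
  define E :: "(real \<Rightarrow> 'a) \<Rightarrow> real" where "E w = (LINT t|period_measure T. (norm (w t))\<^sup>2)" for w
  \<comment> \<open>The energy bound is built into the sets, so the infima \<open>D n\<close> stay
    below B and the limit inherits it; the parallelogram law shows that midpoints keep it
    too.\<close>
  define Q where "Q e = {w. E w \<le> B \<and>
    (\<exists>y. has_L2_derivative T y w \<and> (\<forall>t\<in>{0..T}. norm (y t - x t) \<le> e))}" for e
  define D where "D n = Inf (E ` Q (1 / Suc n))" for n :: nat
  have E_nonneg: "E w \<ge> 0" for w
    by (simp add: E_def)
  have bdd: "bdd_below (E ` S)" for S
    using E_nonneg by (auto intro!: bdd_belowI[of _ 0])
  have ne: "Q e \<noteq> {}" if "e > 0" for e
  proof -
    obtain n where "\<forall>t\<in>{0..T}. dist (xs n t) (x t) < e"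
      using uniform_limitD[OF lim \<open>e > 0\<close>] by (auto simp: eventually_sequentially)
    then have "vs n \<in> Q e"
      using deriv[of n] bound[of n] by (auto simp: Q_def E_def dist_norm less_imp_le)
    then show ?thesis
      by blast
  qed
  have mono: "Q e \<subseteq> Q e'" if "e \<le> e'" for e e'
    using that by (auto simp: Q_def) (meson order_trans)
  have D_mono: "D i \<le> D j" if "i \<le> j" for i j
    unfolding D_def using that ne
    by (intro cInf_superset_mono image_mono mono bdd) (auto simp: frac_le)
  have D_le: "D n \<le> B" for n
  proof -
    obtain w where "w \<in> Q (1 / Suc n)"
      using ne[of "1 / Suc n"] by auto
    then show ?thesis
      unfolding D_def by (intro cInf_lower2[of "E w"] bdd) (auto simp: Q_def)
  qed
  have D_lower: "D n \<le> E w" if "w \<in> Q (1 / Suc n)" for n w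
    unfolding D_def using that by (intro cInf_lower bdd) auto
  have "\<exists>w. w \<in> Q (1 / Suc n) \<and> E w < D n + 1 / Suc n" for n
    using cInf_lessD[of "E ` Q (1 / Suc n)" "D n + 1 / Suc n"] ne[of "1 / Suc n"]
    by (auto simp: D_def)
  then obtain w where w: "\<And>n. w n \<in> Q (1 / Suc n)" "\<And>n. E (w n) < D n + 1 / Suc n"
    by metis
  then have "\<exists>y. has_L2_derivative T y (w n) \<and> (\<forall>t\<in>{0..T}. norm (y t - x t) \<le> 1 / Suc n)" for n
    by (simp add: Q_def)
  then obtain y where y: "\<And>n. has_L2_derivative T (y n) (w n)"
    "\<And>n t. t \<in> {0..T} \<Longrightarrow> norm (y n t - x t) \<le> 1 / Suc n"
    by metis
  have wmeas: "w n \<in> borel_measurable (period_measure T)" for n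
    using y(1) by (rule has_L2_derivative_measurable)
  have wint: "integrable (period_measure T) (\<lambda>t. (norm (w n t))\<^sup>2)" for n
    using y(1) by (rule has_L2_derivative_square_integrable)
  have Ew: "E (w n) \<le> B" for n
    using w(1)[of n] by (simp add: Q_def)
  have para: "E (\<lambda>t. w i t - w j t) = 2 * E (w i) + 2 * E (w j) - 4 * E (\<lambda>t. (1/2) *\<^sub>R (w i t + w j t))"
    for i j
  proof -
    have *: "(norm (a - b))\<^sup>2 = 2 * (norm a)\<^sup>2 + 2 * (norm b)\<^sup>2 - 4 * (norm ((1/2) *\<^sub>R (a + b)))\<^sup>2"
      for a b :: 'a
    proof -
      have "4 * (norm ((1/2) *\<^sub>R (a + b)))\<^sup>2 = (norm (a + b))\<^sup>2"
        by (simp add: power_divide)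
      then show ?thesis
        by (simp add: power2_norm_eq_inner inner_simps inner_commute)
    qed
    have "integrable (period_measure T) (\<lambda>t. (norm ((1/2) *\<^sub>R (w i t + w j t)))\<^sup>2)"
      by (intro square_integrable_scaleR square_integrable_add wint wmeas)
    then show ?thesis
      unfolding E_def * using wint by simp
  qed
  have Cauchy: "\<exists>N. \<forall>i\<ge>N. \<forall>j\<ge>N. E (\<lambda>t. w i t - w j t) < e" if "e > 0" for e
  proof -
    have "incseq D"
      using D_mono by (auto simp: incseq_def)
    then obtain d where d: "D \<longlonglongrightarrow> d" "\<And>n. D n \<le> d"
      using incseq_convergent[of D B] D_le by blast
    \<comment> \<open>Origin of this expression: \<open>w i\<close> and \<open>w j\<close> have
      energy below d + q, and their midpoint lies in the N-th set, so its energy is at least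
      \<open>D N\<close>. The parallelogram law bounds their squared distance by 4 (d + q) - 4
      \<open>D N\<close>.\<close>
    have "(\<lambda>n. 4 * (d - D n) + 4 * (1 / real (Suc n))) \<longlonglongrightarrow> 4 * (d - d) + 4 * 0"
      by (intro tendsto_intros d LIMSEQ_Suc[OF lim_1_over_n])
    then have "\<forall>\<^sub>F n in sequentially. 4 * (d - D n) + 4 * (1 / real (Suc n)) < e"
      using that by (intro order_tendstoD(2)[of _ 0]) auto
    then obtain N where N: "4 * (d - D N) + 4 * (1 / real (Suc N)) < e"
      by (auto simp: eventually_sequentially)
    define q where "q = 1 / real (Suc N)"
    have Ew_less: "E (w k) < d + q" if "k \<ge> N" for k
      using that by (intro less_le_trans[OF w(2)] add_mono d) (simp add: q_def frac_le)
    have "E (\<lambda>t. w i t - w j t) < e" if "i \<ge> N" "j \<ge> N" for i j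
    proof -
      have inv: "1 / real (Suc i) \<le> 1 / Suc N" "1 / real (Suc j) \<le> 1 / Suc N"
        using that by (auto simp: frac_le)
      let ?m = "\<lambda>t. (1/2) *\<^sub>R (w i t + w j t)"
      have "has_L2_derivative T (\<lambda>t. (1/2) *\<^sub>R (y i t + y j t)) ?m"
        by (intro has_L2_derivative_scaleR has_L2_derivative_add y)
      moreover have "norm ((1/2) *\<^sub>R (y i t + y j t) - x t) \<le> 1 / Suc N" if t: "t \<in> {0..T}" for t
      proof -
        have "(1/2) *\<^sub>R (y i t + y j t) - x t = (1/2) *\<^sub>R ((y i t - x t) + (y j t - x t))"
          by (simp add: algebra_simps flip: scaleR_add_left)
        then have "norm ((1/2) *\<^sub>R (y i t + y j t) - x t) \<le> (1/2) * (norm (y i t - x t) + norm (y j t - x t))"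
          using norm_triangle_ineq by simp
        then show ?thesis
          using order_trans[OF y(2)[OF t] inv(1)] order_trans[OF y(2)[OF t] inv(2)]
          unfolding mult.commute[of "1/2"] by argo
      qed
      moreover have "E ?m \<le> B"
        using para[of i j] Ew[of i] Ew[of j] E_nonneg[of "\<lambda>t. w i t - w j t"] by linarith
      ultimately have "?m \<in> Q (1 / Suc N)"
        by (auto simp: Q_def)
      then have "D N \<le> E ?m"
        by (rule D_lower)
      then show ?thesis
        using para[of i j] Ew_less[of i] Ew_less[of j] N that unfolding q_def[symmetric]
        by argo
    qed
    then show ?thesis
      by blast
  qed
  obtain v where v: "v \<in> borel_measurable (period_measure T)"
    "integrable (period_measure T) (\<lambda>t. (norm (v t))\<^sup>2)"
    "(\<lambda>n. E (\<lambda>t. w n t - v t)) \<longlonglongrightarrow> 0" "E v \<le> B"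
  proof (rule period_measure.L2_complete[OF wmeas wint Cauchy[unfolded E_def]])
    fix g
    assume "g \<in> borel_measurable (period_measure T)"
      "integrable (period_measure T) (\<lambda>t. (norm (g t))\<^sup>2)"
      "(\<lambda>n. LINT t|period_measure T. (norm (w n t - g t))\<^sup>2) \<longlonglongrightarrow> 0"
      "\<And>B. (\<And>n. (LINT t|period_measure T. (norm (w n t))\<^sup>2) \<le> B) \<Longrightarrow>
        (LINT t|period_measure T. (norm (g t))\<^sup>2) \<le> B"
    then show thesis
      using Ew by (intro that[of g]) (simp_all only: E_def)
  qed
  have ylim: "(\<lambda>n. y n t) \<longlonglongrightarrow> x t" if "t \<in> {0..T}" for t
  proof -
    have "(\<lambda>n. y n t - x t) \<longlonglongrightarrow> 0"
      using y(2)[OF that] by (intro Lim_null_comparison[OF _ LIMSEQ_Suc[OF lim_1_over_n]]) auto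
    then show ?thesis
      by (rule LIM_zero_cancel)
  qed
  have "x t = x 0 + (LINT s:{0..t}|period_measure T. v s)" if t: "t \<in> {0..T}" for t
  proof -
    have meas: "{0..t} \<in> sets (period_measure T)"
      using t by (auto simp: sets_restrict_space_iff)
    have le: "norm ((LINT s:{0..t}|period_measure T. w n s) - (LINT s:{0..t}|period_measure T. v s))
        \<le> sqrt t * sqrt (E (\<lambda>t. w n t - v t))" for n
    proof -
      have "(LINT s:{0..t}|period_measure T. w n s - v s) =
          (LINT s:{0..t}|period_measure T. w n s) - (LINT s:{0..t}|period_measure T. v s)"
        using integrable_mult_indicator[OF meas has_L2_derivative_integrable[OF y(1)], of n]
          integrable_mult_indicator[OF meas period_measure.L1_le_L2(1)[OF v(1,2)]]
        by (intro set_integral_diff) (simp_all add: set_integrable_def)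
      moreover have "norm (LINT s:{0..t}|period_measure T. w n s - v s)
          \<le> sqrt (measure (period_measure T) {0..t}) * sqrt (E (\<lambda>t. w n t - v t))"
        unfolding E_def
        by (intro period_measure.norm_set_integral_le_L2 square_integrable_diff
            borel_measurable_diff wmeas wint v(1,2) meas)
      ultimately show ?thesis
        using t measure_period_measure[of 0 T t] by simp
    qed
    have "(\<lambda>n. sqrt t * sqrt (E (\<lambda>t. w n t - v t))) \<longlonglongrightarrow> sqrt t * sqrt 0"
      by (intro tendsto_intros v)
    then have "(\<lambda>n. sqrt t * sqrt (E (\<lambda>t. w n t - v t))) \<longlonglongrightarrow> 0"
      by simp
    then have "(\<lambda>n. (LINT s:{0..t}|period_measure T. w n s) -
        (LINT s:{0..t}|period_measure T. v s)) \<longlonglongrightarrow> 0"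
      by (rule Lim_null_comparison[OF always_eventually[OF allI[OF le]]])
    then have "(\<lambda>n. LINT s:{0..t}|period_measure T. w n s) \<longlonglongrightarrow> (LINT s:{0..t}|period_measure T. v s)"
      by (rule LIM_zero_cancel)
    then have "(\<lambda>n. y n 0 + (LINT s:{0..t}|period_measure T. w n s))
        \<longlonglongrightarrow> x 0 + (LINT s:{0..t}|period_measure T. v s)"
      using t by (intro tendsto_add ylim) auto
    moreover have "y n 0 + (LINT s:{0..t}|period_measure T. w n s) = y n t" for n
      using has_L2_derivative_integral[OF y(1) t, of n] by simp
    ultimately show ?thesis
      using ylim[OF t] by (simp only: LIMSEQ_unique)
  qed
  then have "has_L2_derivative T x v"
    using v(1,2) unfolding has_L2_derivative_iff by (intro conjI ballI)
  then show thesis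
    using that v(4) by (simp add: E_def)
qed

section \<open>Periodic functions and their primitives\<close>

lemma periodic_rcong:
  fixes x :: "real \<Rightarrow> 'a"
  assumes "\<And>t. x (t + T) = x t" "[s = t] (rmod T)"
  shows "x s = x t"
proof -
  interpret periodic_fun_simple x T
    using assms(1) by unfold_locales
  show ?thesis
    using assms(2) plus_of_int by (auto simp: rcong_altdef)
qed

lemma periodic_rmod:
  fixes x :: "real \<Rightarrow> 'a"
  assumes "\<And>t. x (t + T) = x t"
  shows "x (t rmod T) = x t"
  by (rule periodic_rcong[where x = x, OF assms]) (simp add: rcong_def)

lemma rmod_in_period: "T > 0 \<Longrightarrow> t rmod T \<in> {0..T}"
  using rmod_nonneg[of T t] rmod_less[of T t] by auto

lemma periodic_continuous:
  fixes x :: "real \<Rightarrow> 'a::t2_space"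
  assumes per: "\<And>t. x (t + T) = x t" and T: "T > 0" and cont: "continuous_on {0..T} x"
  shows "continuous_on UNIV x"
proof (rule continuous_at_imp_continuous_on, intro ballI)
  fix t :: real
  \<comment> \<open>The endpoint 0 of the period is the delicate point; after gluing on the shifted
    copy, every \<open>t rmod T\<close> is interior to the domain.\<close>
  have "continuous_on {- T..0} (\<lambda>s. x (s + T))"
    by (rule continuous_on_compose2[OF cont]) (auto intro!: continuous_intros)
  then have "continuous_on {- T..0} x"
    by (simp only: per)
  then have "continuous_on ({- T..0} \<union> {0..T}) x"
    using cont by (intro continuous_on_closed_Un closed_atLeastAtMost)
  then have "continuous_on {- T<..<T} x"
    by (rule continuous_on_subset) auto
  moreover have "t rmod T \<in> {- T<..<T}"
    using T rmod_nonneg[of T t] rmod_less[of T t] by auto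
  ultimately have "isCont x (t rmod T)"
    by (simp add: continuous_on_eq_continuous_at)
  then have "isCont (\<lambda>s. x (s + (t rmod T - t))) t"
    using isCont_o2[of t "\<lambda>s. s + (t rmod T - t)" x] by simp
  moreover have "x (s + (t rmod T - t)) = x s" for s
  proof (rule periodic_rcong[where x = x, OF per])
    have "[s + (t rmod T - t) = s + (t - t)] (rmod T)"
      by (intro rcong_add rcong_diff rcong_refl) (simp add: rcong_def)
    then show "[s + (t rmod T - t) = s] (rmod T)"
      by simp
  qed
  ultimately show "isCont x t"
    by simp
qed

lemma has_vector_derivative_reflect:
  fixes A :: "'a::euclidean_space \<Rightarrow> 'b::euclidean_space"
  assumes A: "linear A" and P: "\<And>t. (P has_vector_derivative p t) (at t)"
  shows "((\<lambda>t. A (P (b - t))) has_vector_derivative - A (p (b - t))) (at t)"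
proof -
  have "((\<lambda>t. b - t) has_vector_derivative -1) (at t)"
    by (auto intro!: derivative_eq_intros)
  from vector_diff_chain_at[OF this P]
  have "((\<lambda>t. P (b - t)) has_vector_derivative (-1) *\<^sub>R p (b - t)) (at t)"
    by (simp add: o_def)
  then have "((\<lambda>t. A (P (b - t))) has_vector_derivative A ((-1) *\<^sub>R p (b - t))) (at t)"
    by (rule bounded_linear.has_vector_derivative[OF A[unfolded linear_conv_bounded_linear]])
  then show ?thesis
    by (simp add: linear_neg[OF A])
qed

lemma constant_if_derivative_zero:
  fixes P :: "real \<Rightarrow> 'a::real_normed_vector"
  assumes "\<And>t. (P has_vector_derivative 0) (at t)"
  shows "P s = P t"
proof -
  have "(P has_derivative (\<lambda>h. 0)) (at t)" for t
    using assms[of t] by (simp add: has_vector_derivative_def)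
  then show ?thesis
    using has_derivative_zero_constant[of UNIV P] by (metis UNIV_I convex_UNIV)
qed

lemma periodic_const_derivative_zero:
  fixes P :: "real \<Rightarrow> 'a::real_normed_vector"
  assumes "\<And>t. (P has_vector_derivative c) (at t)" "P T = P 0" "T \<noteq> 0"
  shows "c = 0"
proof -
  have "((\<lambda>t. P t - t *\<^sub>R c) has_vector_derivative 0) (at t)" for t
    using assms(1) by (auto intro!: derivative_eq_intros)
  from constant_if_derivative_zero[OF this, of T 0] show ?thesis
    using assms by simp
qed

text \<open>The increment F (t + T) - F t of a primitive has zero derivative, so F is periodic up to
  a linear drift. The constant c removes this drift and is the mean of f.\<close>

lemma periodic_primitive:
  fixes f :: "real \<Rightarrow> 'a::euclidean_space"
  assumes cont: "continuous_on UNIV f" and per: "\<And>t. f (t + T) = f t" and T: "T > 0"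
  obtains c P where "\<And>t. (P has_vector_derivative f t - c) (at t)" "\<And>t. P (t + T) = P t"
proof -
  obtain F where F: "\<And>t. (F has_vector_derivative f t) (at t)"
    using einterval_antiderivative[of "-\<infinity>" "\<infinity>" f] cont
    by (auto simp: continuous_on_eq_continuous_at)
  have "((\<lambda>t. F (t + T)) has_vector_derivative f (t + T)) (at t)" for t
  proof -
    have "((\<lambda>t. t + T) has_vector_derivative 1) (at t)"
      by (auto intro!: derivative_eq_intros)
    from vector_diff_chain_at[OF this F] show ?thesis
      by (simp add: o_def)
  qed
  then have "((\<lambda>t. F (t + T) - F t) has_vector_derivative f (t + T) - f t) (at t)" for t
    using F by (intro has_vector_derivative_diff)
  then have inc: "F (t + T) - F t = F T - F 0" for t
    using constant_if_derivative_zero[of "\<lambda>t. F (t + T) - F t" t 0] per by simp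
  define c where "c = (1 / T) *\<^sub>R (F T - F 0)"
  show thesis
  proof (rule that[of "\<lambda>t. F t - t *\<^sub>R c" c])
    show "((\<lambda>t. F t - t *\<^sub>R c) has_vector_derivative f t - c) (at t)" for t
      using F by (auto intro!: derivative_eq_intros)
    have "T *\<^sub>R c = F T - F 0"
      using T by (simp add: c_def)
    then show "F (t + T) - (t + T) *\<^sub>R c = F t - t *\<^sub>R c" for t
      using inc[of t] by (simp add: scaleR_add_left) (metis add_diff_cancel_left' add_diff_eq diff_add_cancel)
  qed
qed

text \<open>
  Subtracting its mean from a periodic function turns a time-reversing symmetry up to a constant
  into an exact symmetry: the integral of the defect over a period vanishes.
\<close>

lemma periodic_mean_symmetric:
  fixes p :: "real \<Rightarrow> 'a::euclidean_space"
  assumes P: "\<And>t. (P has_vector_derivative p t - c) (at t)" and per: "\<And>t. P (t + T) = P t"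
    and T: "T > 0" and A: "linear A" and sym: "\<And>t. p t = A (p (b - t)) + d"
  shows "p t - c = A (p (b - t) - c)"
proof -
  let ?G = "\<lambda>t. P t + A (P (b - t))"
  have "(?G has_vector_derivative (p t - c) + - A (p (b - t) - c)) (at t)" for t
    using P by (intro has_vector_derivative_add has_vector_derivative_reflect A)
  moreover have "(p t - c) + - A (p (b - t) - c) = d - c + A c" for t
    using sym[of t] by (simp add: linear_diff[OF A])
  ultimately have "(?G has_vector_derivative d - c + A c) (at t)" for t
    by (simp only:)
  moreover have "?G T = ?G 0"
    using per[of 0] per[of "b - T"] by simp
  ultimately have "d - c + A c = 0"
    using periodic_const_derivative_zero[of ?G _ T] T by blast
  then show ?thesis
    using sym[of t] by (simp add: linear_diff[OF A] algebra_simps)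
qed

text \<open>The analogue for a linear constraint, later the vanishing of the weighted sum of
  positions: l P is periodic with constant derivative d - l c, which must therefore be zero.\<close>

lemma periodic_mean_kernel:
  fixes p :: "real \<Rightarrow> 'a::euclidean_space" and l :: "'a \<Rightarrow> 'b::euclidean_space"
  assumes P: "\<And>t. (P has_vector_derivative p t - c) (at t)" and per: "\<And>t. P (t + T) = P t"
    and T: "T > 0" and l: "linear l" and const: "\<And>t. l (p t) = d"
  shows "l (p t - c) = 0"
proof -
  have "((\<lambda>t. l (P t)) has_vector_derivative l (p t - c)) (at t)" for t
    by (rule bounded_linear.has_vector_derivative[OF l[unfolded linear_conv_bounded_linear] P])
  then have "((\<lambda>t. l (P t)) has_vector_derivative d - l c) (at t)" for t
    by (simp add: linear_diff[OF l] const)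
  then have "d - l c = 0"
    by (rule periodic_const_derivative_zero[where T = T]) (use per[of 0] T in auto)
  then show ?thesis
    by (simp add: linear_diff[OF l] const)
qed

text \<open>Reversing time changes the sign of a derivative, so integration replaces the symmetry A
  by - A, up to an integration constant.\<close>

lemma symmetric_primitive:
  fixes p :: "real \<Rightarrow> 'a::euclidean_space"
  assumes A: "linear A" and P: "\<And>t. (P has_vector_derivative p t) (at t)"
    and sym: "\<And>t. p t = A (p (b - t))"
  obtains d where "\<And>t. P t = - A (P (b - t)) + d"
proof -
  have "((\<lambda>t. P t + A (P (b - t))) has_vector_derivative p t + - A (p (b - t))) (at t)" for t
    using P by (intro has_vector_derivative_add has_vector_derivative_reflect A)
  then have "((\<lambda>t. P t + A (P (b - t))) has_vector_derivative 0) (at t)" for t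
    by (simp flip: sym)
  from constant_if_derivative_zero[OF this]
  have "P t = - A (P (b - t)) + (P 0 + A (P (b - 0)))" for t
    by (metis add.commute minus_add_cancel)
  then show thesis
    by (rule that)
qed

text \<open>The obstruction to a periodic primitive is the mean of f. It inherits both symmetries of
  f, so \<open>fixed\<close> makes it zero. Two integrations change A to - A and back to A, and
  subtracting the mean after each of them removes the integration constants.\<close>

lemma symmetric_double_primitive:
  fixes f :: "real \<Rightarrow> 'a::euclidean_space" and l :: "'a \<Rightarrow> 'b::euclidean_space"
  assumes cont: "continuous_on UNIV f" and per: "\<And>t. f (t + T) = f t" and T: "T > 0"
    and A1: "linear A1" and A2: "linear A2" and l: "linear l"
    and f1: "\<And>t. f t = A1 (f (b1 - t))" and f2: "\<And>t. f t = A2 (f (b2 - t))"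
    and lf: "\<And>t. l (f t) = 0"
    and fixed: "\<And>c. A1 c = c \<Longrightarrow> A2 c = c \<Longrightarrow> c = 0"
  obtains p q where "\<And>t. (q has_vector_derivative p t) (at t)"
    "\<And>t. (p has_vector_derivative f t) (at t)" "\<And>t. q (t + T) = q t" "\<And>t. p (t + T) = p t"
    "\<And>t. q t = A1 (q (b1 - t))" "\<And>t. q t = A2 (q (b2 - t))" "\<And>t. l (q t) = 0"
proof -
  have l_const: "\<exists>d. \<forall>t. l (P t) = d" if "\<And>t. (P has_vector_derivative p t) (at t)" "\<And>t. l (p t) = 0"
    for P p
  proof -
    have "((\<lambda>t. l (P t)) has_vector_derivative l (p t)) (at t)" for t
      by (rule bounded_linear.has_vector_derivative[OF l[unfolded linear_conv_bounded_linear] that(1)])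
    then show ?thesis
      using constant_if_derivative_zero[of "\<lambda>t. l (P t)"] that(2) by metis
  qed
  have neg: "linear (\<lambda>z. - A1 z)" "linear (\<lambda>z. - A2 z)"
    using A1 A2 by (auto intro: linear_compose_neg)
  obtain P c where P: "\<And>t. (P has_vector_derivative f t - c) (at t)" "\<And>t. P (t + T) = P t"
    using periodic_primitive[OF cont per T] by metis
  have "A1 c = c"
  proof -
    have "f 0 - c = A1 (f (b1 - 0) - c)"
      by (rule periodic_mean_symmetric[OF P T A1, where d = 0]) (unfold add_0_right, rule f1)
    then show ?thesis
      unfolding linear_diff[OF A1] f1[of 0, symmetric] by simp
  qed
  moreover have "A2 c = c"
  proof -
    have "f 0 - c = A2 (f (b2 - 0) - c)"
      by (rule periodic_mean_symmetric[OF P T A2, where d = 0]) (unfold add_0_right, rule f2)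
    then show ?thesis
      unfolding linear_diff[OF A2] f2[of 0, symmetric] by simp
  qed
  ultimately have "c = 0"
    by (rule fixed)
  then have P': "\<And>t. (P has_vector_derivative f t) (at t)"
    using P(1) by simp
  obtain d1 where P1: "\<And>t. P t = - A1 (P (b1 - t)) + d1"
    by (rule symmetric_primitive[OF A1 P' f1]) (rule that)
  obtain d2 where P2: "\<And>t. P t = - A2 (P (b2 - t)) + d2"
    by (rule symmetric_primitive[OF A2 P' f2]) (rule that)
  obtain d3 where P3: "\<And>t. l (P t) = d3"
    using l_const[OF P' lf] by blast
  have contP: "continuous_on UNIV P"
    using P' by (intro continuous_at_imp_continuous_on ballI has_vector_derivative_continuous)
  obtain Q c1 where Q: "\<And>t. (Q has_vector_derivative P t - c1) (at t)" "\<And>t. Q (t + T) = Q t"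
    by (rule periodic_primitive[OF contP P(2) T]) (rule that)
  define p where "p = (\<lambda>t. P t - c1)"
  have p: "(Q has_vector_derivative p t) (at t)" "p (t + T) = p t" for t
    using Q(1) P(2) by (simp_all add: p_def)
  have p': "(p has_vector_derivative f t) (at t)" for t
    using has_vector_derivative_diff[OF P' has_vector_derivative_const[of c1]] by (simp add: p_def)
  have p1: "p t = - A1 (p (b1 - t))" for t
    unfolding p_def by (rule periodic_mean_symmetric[where p = P and d = d1, OF Q T neg(1) P1])
  have p2: "p t = - A2 (p (b2 - t))" for t
    unfolding p_def by (rule periodic_mean_symmetric[where p = P and d = d2, OF Q T neg(2) P2])
  have p3: "l (p t) = 0" for t
    unfolding p_def by (rule periodic_mean_kernel[where p = P and d = d3, OF Q T l P3])
  obtain d1 where Q1: "\<And>t. Q t = A1 (Q (b1 - t)) + d1"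
    by (rule symmetric_primitive[OF neg(1) p(1) p1, unfolded minus_minus]) (rule that)
  obtain d2 where Q2: "\<And>t. Q t = A2 (Q (b2 - t)) + d2"
    by (rule symmetric_primitive[OF neg(2) p(1) p2, unfolded minus_minus]) (rule that)
  obtain d3 where Q3: "\<And>t. l (Q t) = d3"
    using l_const[OF p(1) p3] by blast
  have contQ: "continuous_on UNIV Q"
    using p(1) by (intro continuous_at_imp_continuous_on ballI has_vector_derivative_continuous)
  \<comment> \<open>This third primitive only serves to identify c2 as the mean of Q, which is what
    makes the symmetries of Q - c2 exact.\<close>
  obtain R c2 where R: "\<And>t. (R has_vector_derivative Q t - c2) (at t)" "\<And>t. R (t + T) = R t"
    by (rule periodic_primitive[OF contQ Q(2) T]) (rule that)
  show thesis
  proof (rule that[of "\<lambda>t. Q t - c2" p])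
    show "((\<lambda>t. Q t - c2) has_vector_derivative p t) (at t)" for t
      using has_vector_derivative_diff[OF p(1) has_vector_derivative_const[of c2]] by simp
    show "Q t - c2 = A1 (Q (b1 - t) - c2)" for t
      by (rule periodic_mean_symmetric[where p = Q and d = d1, OF R T A1 Q1])
    show "Q t - c2 = A2 (Q (b2 - t) - c2)" for t
      by (rule periodic_mean_symmetric[where p = Q and d = d2, OF R T A2 Q2])
    show "l (Q t - c2) = 0" for t
      by (rule periodic_mean_kernel[where p = Q and d = d3, OF R T l Q3])
  qed (simp_all only: p' p(2) Q(2))
qed

section \<open>Integration by parts\<close>

lemma vector_derivative_integral:
  fixes p :: "real \<Rightarrow> 'a::euclidean_space"
  assumes p: "\<And>t. (p has_vector_derivative f t) (at t)" and cont: "continuous_on UNIV f"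
    and "0 \<le> a" "a \<le> b" "b \<le> T"
  shows "(LINT t:{a..b}|period_measure T. f t) = p b - p a"
proof -
  have "(LINT t:{a..b}|period_measure T. f t) = (LINT t:{a..b}|lborel. f t)"
    using assms by (intro set_integral_period_measure) auto
  also have "\<dots> = p b - p a"
    unfolding set_lebesgue_integral_def using assms
    by (intro integral_FTC_atLeastAtMost)
      (auto intro: has_vector_derivative_at_within continuous_on_subset)
  finally show ?thesis .
qed

lemma vector_derivative_has_L2_derivative:
  fixes p :: "real \<Rightarrow> 'a::euclidean_space"
  assumes p: "\<And>t. (p has_vector_derivative f t) (at t)" and cont: "continuous_on UNIV f"
  shows "has_L2_derivative T p f"
  unfolding has_L2_derivative_iff
proof (intro conjI ballI)
  have cont': "continuous_on {0..T} f"
    using cont by (rule continuous_on_subset) simp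
  then show "f \<in> borel_measurable (period_measure T)"
    by (rule continuous_measurable_period_measure)
  show "integrable (period_measure T) (\<lambda>t. (norm (f t))\<^sup>2)"
    using cont' by (intro continuous_integrable_period_measure continuous_intros)
  show "p t = p 0 + (LINT s:{0..t}|period_measure T. f s)" if "t \<in> {0..T}" for t
    using vector_derivative_integral[OF p cont, of 0 t T] that by simp
qed

text \<open>Since x has only an L2 derivative, a pointwise product rule is not at hand. Instead
  \<open>f t \<bullet> w s\<close> is integrated over the triangle s \<le> t in both orders.\<close>

lemma integration_by_parts_L2:
  fixes p x :: "real \<Rightarrow> 'a::euclidean_space"
  assumes T: "T \<ge> 0" and p: "\<And>t. (p has_vector_derivative f t) (at t)"
    and cont: "continuous_on UNIV f" and x: "has_L2_derivative T x w"
  shows "(LINT t|period_measure T. f t \<bullet> x t) =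
    p T \<bullet> x T - p 0 \<bullet> x 0 - (LINT t|period_measure T. p t \<bullet> w t)"
proof -
  let ?M = "period_measure T"
  interpret pair_sigma_finite ?M ?M
    by unfold_locales
  have cont': "continuous_on {0..T} f" and contp: "continuous_on {0..T} p"
    using cont has_L2_derivative_continuous_on[OF vector_derivative_has_L2_derivative[OF p cont]]
    by (auto intro: continuous_on_subset)
  have [measurable]: "f \<in> borel_measurable ?M" "w \<in> borel_measurable ?M" "p \<in> borel_measurable ?M"
    using continuous_measurable_period_measure[OF cont'] has_L2_derivative_measurable[OF x]
      continuous_measurable_period_measure[OF contp] by auto
  have fint: "integrable ?M f" and wint: "integrable ?M w"
    using continuous_integrable_period_measure[OF cont'] has_L2_derivative_integrable[OF x] by auto
  have pw: "integrable ?M (\<lambda>t. p t \<bullet> w t)"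
    by (intro square_integrable_inner has_L2_derivative_square_integrable[OF x]
        has_L2_derivative_measurable[OF x] continuous_measurable_period_measure contp
        continuous_integrable_period_measure continuous_intros)
  have space: "space ?M = {0..T}"
    by (simp add: space_restrict_space)
  \<comment> \<open>Integrating k over s recovers the increment of x from 0 to t; integrating it
    over t recovers the increment of p from s to T.\<close>
  define k where "k t s = indicator {s..T} t *\<^sub>R (f t \<bullet> w s)" for t s :: real
  have [measurable]: "(\<lambda>(t, s). k t s) \<in> borel_measurable (?M \<Otimes>\<^sub>M ?M)"
  proof -
    have "(\<lambda>(t, s). k t s) = (\<lambda>(t, s). if s \<le> t \<and> t \<le> T then f t \<bullet> w s else 0)"
      by (auto simp: k_def fun_eq_iff indicator_def)
    moreover have [measurable]: "(\<lambda>t. t) \<in> borel_measurable ?M"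
      by (intro continuous_measurable_period_measure continuous_intros)
    ultimately show ?thesis
      by simp
  qed
  obtain B where "\<forall>t\<in>{0..T}. norm (f t) \<le> B"
    using compact_imp_bounded[OF compact_continuous_image[OF cont' compact_Icc]]
    by (auto simp: bounded_iff)
  then have B: "norm (f t) \<le> B" if "t \<in> {0..T}" for t
    using that by blast
  \<comment> \<open>A majorant for Fubini: the continuous f is bounded on the period by B.\<close>
  have "integrable (?M \<Otimes>\<^sub>M ?M) (\<lambda>(t, s). B * norm (w s))"
    by (rule Fubini_integrable) (use wint in auto)
  then have kint: "integrable (?M \<Otimes>\<^sub>M ?M) (\<lambda>(t, s). k t s)"
  proof (rule Bochner_Integration.integrable_bound)
    have "norm (k t s) \<le> norm (B * norm (w s))" if "t \<in> {0..T}" for t s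
    proof -
      have "norm (k t s) \<le> \<bar>f t \<bullet> w s\<bar>"
        by (auto simp: k_def indicator_def)
      also have "\<dots> \<le> norm (f t) * norm (w s)"
        by (rule Cauchy_Schwarz_ineq2)
      also have "\<dots> \<le> B * norm (w s)"
        using B[OF that] by (intro mult_right_mono) auto
      finally show ?thesis
        by simp
    qed
    then show "AE x in ?M \<Otimes>\<^sub>M ?M. norm (case x of (t, s) \<Rightarrow> k t s) \<le> norm (case x of (t, s) \<Rightarrow> B * norm (w s))"
      by (intro AE_I2) (auto simp: space_pair_measure space)
  qed measurable
  have inner1: "(LINT s|?M. k t s) = f t \<bullet> (x t - x 0)" if t: "t \<in> {0..T}" for t
  proof -
    have meas: "{0..t} \<in> sets ?M"
      using t by (auto simp: sets_restrict_space_iff)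
    have "(LINT s|?M. k t s) = (LINT s|?M. f t \<bullet> (indicator {0..t} s *\<^sub>R w s))"
      using t by (intro Bochner_Integration.integral_cong) (auto simp: k_def indicator_def space)
    also have "\<dots> = f t \<bullet> (LINT s:{0..t}|?M. w s)"
      unfolding set_lebesgue_integral_def
      by (intro integral_inner_right integrable_mult_indicator meas wint)
    finally show ?thesis
      using has_L2_derivative_integral[OF x t] by (metis add_diff_cancel_left')
  qed
  have inner2: "(LINT t|?M. k t s) = (p T - p s) \<bullet> w s" if s: "s \<in> {0..T}" for s
  proof -
    have meas: "{s..T} \<in> sets ?M"
      using s by (auto simp: sets_restrict_space_iff)
    have "(LINT t|?M. k t s) = (LINT t|?M. (indicator {s..T} t *\<^sub>R f t) \<bullet> w s)"
      by (simp add: k_def)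
    also have "\<dots> = (LINT t:{s..T}|?M. f t) \<bullet> w s"
      unfolding set_lebesgue_integral_def
      by (intro integral_inner_left integrable_mult_indicator meas fint)
    finally show ?thesis
      using vector_derivative_integral[OF p cont, of s T T] s by simp
  qed
  have fx: "(LINT t|?M. f t \<bullet> (x t - x 0)) = (LINT t|?M. LINT s|?M. k t s)"
    by (intro Bochner_Integration.integral_cong refl) (simp add: inner1 space)
  have "(LINT t|?M. f t) = (LINT t:{0..T}|?M. f t)" "(LINT t|?M. w t) = (LINT t:{0..T}|?M. w t)"
    using set_integral_space[OF fint] set_integral_space[OF wint] by (simp_all add: space)
  then have fT: "(LINT t|?M. f t) = p T - p 0" and wT: "(LINT t|?M. w t) = x T - x 0"
    using vector_derivative_integral[OF p cont, of 0 T T] has_L2_derivative_integral[OF x, of T] T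
    by (simp_all only: atLeastAtMost_iff) (simp_all add: algebra_simps)
  have cx: "integrable ?M (\<lambda>t. f t \<bullet> (x t - x 0))"
    by (intro continuous_integrable_period_measure continuous_intros cont'
        has_L2_derivative_continuous_on[OF x])
  have "(LINT t|?M. f t \<bullet> x t) = (LINT t|?M. f t \<bullet> (x t - x 0) + f t \<bullet> x 0)"
    by (simp add: inner_diff_right)
  also have "\<dots> = (LINT t|?M. f t \<bullet> (x t - x 0)) + (LINT t|?M. f t) \<bullet> x 0"
    using cx fint by (simp add: integral_inner_left integrable_inner_left)
  also have "(LINT t|?M. f t \<bullet> (x t - x 0)) = (LINT s|?M. LINT t|?M. k t s)"
    unfolding fx using Fubini_integral[OF kint] by simp
  also have "\<dots> = (LINT s|?M. p T \<bullet> w s - p s \<bullet> w s)"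
    by (intro Bochner_Integration.integral_cong refl) (simp add: inner2 space inner_diff_left)
  also have "\<dots> = p T \<bullet> (x T - x 0) - (LINT s|?M. p s \<bullet> w s)"
    using pw wint by (simp add: integral_inner_right integrable_inner_right wT)
  finally show ?thesis
    by (simp add: fT algebra_simps inner_diff_left inner_diff_right)
qed

section \<open>Kinetic energy and Newtonian potential\<close>

text \<open>With c = \<open>mass m\<close> this is the mass matrix; with the square roots of half
  the masses it turns the kinetic energy into a squared Euclidean norm.\<close>

definition weight :: "(4 \<Rightarrow> real) \<Rightarrow> complex ^ 4 \<Rightarrow> complex ^ 4" where
  "weight c x = (\<chi> i. c i *\<^sub>R x $ i)"

lemma linear_weight: "linear (weight c)"
  by (auto simp: linear_iff weight_def vec_eq_iff scaleR_add_right)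

lemma weight_inner: "weight c x \<bullet> y = (\<Sum>i\<in>UNIV. c i * (x $ i \<bullet> y $ i))"
  by (simp add: weight_def inner_vec_def)

lemma weight_inner_commute: "weight c x \<bullet> y = weight c y \<bullet> x"
  unfolding weight_inner by (intro sum.cong refl) (metis inner_commute)

lemma kinetic_eq_inner: "kinetic m v = weight (mass m) v \<bullet> v / 2"
  by (simp add: kinetic_def weight_inner power2_norm_eq_inner sum_divide_distrib)

lemma norm_vec_squared: "(norm (x :: complex ^ 4))\<^sup>2 = (\<Sum>i\<in>UNIV. (norm (x $ i))\<^sup>2)"
  by (simp add: power2_norm_eq_inner inner_vec_def)

lemma mass_pos: "m > 0 \<Longrightarrow> mass m i > 0"
  by (simp add: mass_def)

lemma kinetic_nonneg: "m > 0 \<Longrightarrow> kinetic m v \<ge> 0"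
  by (auto simp: kinetic_def intro!: sum_nonneg mult_nonneg_nonneg less_imp_le[OF mass_pos])

lemma kinetic_lower_bound: "min 1 m / 2 * (norm v)\<^sup>2 \<le> kinetic m v"
  unfolding kinetic_def norm_vec_squared sum_distrib_left
  by (intro sum_mono mult_right_mono) (auto simp: mass_def)

lemma kinetic_eq_norm_weight:
  assumes "m > 0"
  shows "kinetic m v = (norm (weight (\<lambda>i. sqrt (mass m i / 2)) v))\<^sup>2"
  using mass_pos[OF assms]
  by (simp add: kinetic_def norm_vec_squared weight_def power_mult_distrib less_imp_le)

lemma weight_weight: "weight c (weight d x) = weight (\<lambda>i. c i * d i) x"
  by (simp add: weight_def)

lemma weight_one: "weight (\<lambda>i. 1) x = x"
  by (simp add: weight_def)

lemma integrable_kinetic: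
  assumes "has_L2_derivative T x v"
  shows "integrable (period_measure T) (\<lambda>t. weight c (v t) \<bullet> v t)"
proof -
  have w: "has_L2_derivative T (\<lambda>t. weight c (x t)) (\<lambda>t. weight c (v t))"
    using linear_weight assms by (rule has_L2_derivative_linear)
  show ?thesis
    by (rule square_integrable_inner)
      (rule has_L2_derivative_measurable[OF w] has_L2_derivative_measurable[OF assms]
        has_L2_derivative_square_integrable[OF w] has_L2_derivative_square_integrable[OF assms])+
qed

text \<open>Rescaling body i by \<open>sqrt (mass m i / 2)\<close> reduces the claim to the
  Euclidean norm, and positivity of the masses makes the rescaling invertible.\<close>

lemma kinetic_integral_lower_semicontinuous:
  assumes m: "m > 0" and deriv: "\<And>n::nat. has_L2_derivative T (xs n) (vs n)"
    and bound: "\<And>n. (LINT t|period_measure T. kinetic m (vs n t)) \<le> B"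
    and lim: "uniform_limit {0..T} xs x sequentially"
  obtains v where "has_L2_derivative T x v" "(LINT t|period_measure T. kinetic m (v t)) \<le> B"
proof -
  define c where "c i = sqrt (mass m i / 2)" for i
  have c: "c i > 0" for i
    using mass_pos[OF m] by (simp add: c_def)
  have kin: "kinetic m v = (norm (weight c v))\<^sup>2" for v
    using kinetic_eq_norm_weight[OF m] by (simp add: c_def[abs_def])
  have lim': "uniform_limit {0..T} (\<lambda>n t. weight c (xs n t)) (\<lambda>t. weight c (x t)) sequentially"
    using linear_weight[of c, unfolded linear_conv_bounded_linear] lim
    by (rule bounded_linear.uniform_limit)
  obtain w where w: "has_L2_derivative T (\<lambda>t. weight c (x t)) w"
    "(LINT t|period_measure T. (norm (w t))\<^sup>2) \<le> B"
    using L2_derivative_lower_semicontinuous[OF has_L2_derivative_linear[OF linear_weight deriv]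
        bound[unfolded kin] lim'] by blast
  have inv: "weight (\<lambda>i. 1 / c i) (weight c z) = z" "weight c (weight (\<lambda>i. 1 / c i) z) = z" for z
    using c by (auto simp: weight_weight less_imp_neq[symmetric] intro: weight_one)
  show thesis
  proof (rule that)
    show "has_L2_derivative T x (\<lambda>t. weight (\<lambda>i. 1 / c i) (w t))"
      using has_L2_derivative_linear[OF linear_weight[of "\<lambda>i. 1 / c i"] w(1)] by (simp add: inv)
    show "(LINT t|period_measure T. kinetic m (weight (\<lambda>i. 1 / c i) (w t))) \<le> B"
      using w(2) by (simp add: kin inv)
  qed
qed

section \<open>The Newtonian force and the pair potential\<close>

text \<open>Forces are summed over all other bodies, the potential over each unordered pair once;
  this identity translates between the two.\<close>

lemma sum_pairs:
  fixes g :: "'i::{finite, linorder} \<Rightarrow> 'i \<Rightarrow> 'a::comm_monoid_add"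
  shows "(\<Sum>i\<in>UNIV. \<Sum>j\<in>{i<..}. g i j + g j i) = (\<Sum>i\<in>UNIV. \<Sum>j\<in>UNIV - {i}. g i j)"
proof -
  have "(\<Sum>j\<in>UNIV - {i}. g i j) = (\<Sum>j\<in>{i<..}. g i j) + (\<Sum>j\<in>{..<i}. g i j)" for i
    by (subst sum.union_disjoint[symmetric]) (auto intro!: sum.cong)
  moreover have "(\<Sum>i\<in>UNIV. \<Sum>j\<in>{..<i}. g i j) = (\<Sum>i\<in>UNIV. \<Sum>j\<in>{i<..}. g j i)"
    using sum.swap_restrict[of UNIV UNIV "\<lambda>i j. g i j" "\<lambda>i j. j < i"]
    by (simp add: lessThan_def greaterThan_def)
  ultimately show ?thesis
    by (simp add: sum.distrib)
qed

text \<open>At a collision the summand is zero by the convention for division by zero, so momentum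
  conservation and equivariance hold for all configurations.\<close>

definition acceleration :: "real \<Rightarrow> complex ^ 4 \<Rightarrow> complex ^ 4" where
  "acceleration m x =
     (\<chi> i. \<Sum>j\<in>UNIV - {i}. (mass m j / norm (x $ j - x $ i) ^ 3) *\<^sub>R (x $ j - x $ i))"

text \<open>Newton's third law: the two forces of a pair cancel. It places the loop q with q'' =
  acceleration in the configuration space.\<close>

lemma acceleration_momentum: "(\<Sum>i\<in>UNIV. mass m i *\<^sub>R acceleration m x $ i) = 0"
proof -
  let ?g = "\<lambda>i j. (mass m i * mass m j / norm (x $ j - x $ i) ^ 3) *\<^sub>R (x $ j - x $ i)"
  have "(\<Sum>i\<in>UNIV. mass m i *\<^sub>R acceleration m x $ i) = (\<Sum>i\<in>UNIV. \<Sum>j\<in>UNIV - {i}. ?g i j)"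
    by (simp add: acceleration_def scaleR_sum_right)
  also have "\<dots> = (\<Sum>i\<in>UNIV. \<Sum>j\<in>{i<..}. ?g i j + ?g j i)"
    by (rule sum_pairs[symmetric])
  also have "\<dots> = 0"
  proof (intro sum.neutral ballI)
    fix i j
    have "?g j i = - ?g i j"
      by (simp add: norm_minus_commute[of "x $ i"] mult.commute flip: scaleR_minus_right)
    then show "?g i j + ?g j i = 0"
      by simp
  qed
  finally show ?thesis .
qed

text \<open>A real-valued version of \<open>potential\<close>, faithful only off collisions: there
  real division yields 0 where the potential is infinite.\<close>

definition pair_potential :: "real \<Rightarrow> complex ^ 4 \<Rightarrow> real" where
  "pair_potential m x = (\<Sum>i\<in>UNIV. \<Sum>j\<in>{i<..}. mass m i * mass m j / norm (x $ i - x $ j))"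

lemma potential_eq_pair_potential:
  assumes m: "m > 0" and "\<And>i j. i \<noteq> j \<Longrightarrow> x $ i \<noteq> x $ j"
  shows "potential m x = ennreal (pair_potential m x)"
proof -
  have nonneg: "0 \<le> mass m i * mass m j / norm (x $ i - x $ j)" for i j
    using mass_pos[OF m] by (intro divide_nonneg_nonneg mult_nonneg_nonneg) (auto intro: less_imp_le)
  have "ennreal (mass m i * mass m j) / ennreal (norm (x $ i - x $ j))
      = ennreal (mass m i * mass m j / norm (x $ i - x $ j))" if "j \<in> {i<..}" for i j
    using that assms(2)[of i j] mass_pos[OF m]
    by (intro divide_ennreal) (auto intro: less_imp_le)
  then have "(\<Sum>j\<in>{i<..}. ennreal (mass m i * mass m j) / ennreal (norm (x $ i - x $ j)))
      = ennreal (\<Sum>j\<in>{i<..}. mass m i * mass m j / norm (x $ i - x $ j))" for i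
    using nonneg by (subst sum_ennreal[symmetric]) auto
  then show ?thesis
    unfolding potential_def pair_potential_def using nonneg
    by (subst sum_ennreal[symmetric]) (auto intro!: sum_nonneg)
qed

lemma pair_potential_nonneg: "m > 0 \<Longrightarrow> pair_potential m x \<ge> 0"
  unfolding pair_potential_def
  by (intro sum_nonneg divide_nonneg_nonneg mult_nonneg_nonneg less_imp_le[OF mass_pos]) auto

text \<open>A Taylor estimate of 1 / norm from above, the only direction that comparison with a
  minimizer requires. With a = norm z and b = norm (z + w), the right side minus the left side is
  the square of norm w minus that of b - a, times a positive factor; the triangle inequality bounds
  \<bar>b - a\<bar> by norm w.\<close>

lemma inverse_norm_add_le:
  fixes z w :: "'a::real_inner"
  assumes "z \<noteq> 0" "z + w \<noteq> 0"
  shows "1 / norm (z + w) \<le> 1 / norm z - (z \<bullet> w) / norm z ^ 3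
    + (norm w)\<^sup>2 / ((norm z)\<^sup>2 * norm (z + w))"
proof -
  define a where "a = norm z"
  define b where "b = norm (z + w)"
  have ab: "a > 0" "b > 0"
    using assms by (auto simp: a_def b_def)
  have "b\<^sup>2 - a\<^sup>2 = 2 * (z \<bullet> w) + (norm w)\<^sup>2"
    by (simp add: a_def b_def power2_norm_eq_inner inner_simps inner_commute)
  then have zw: "z \<bullet> w = (b\<^sup>2 - a\<^sup>2 - (norm w)\<^sup>2) / 2"
    by simp
  have "\<bar>b - a\<bar> \<le> norm w"
    unfolding a_def b_def using norm_triangle_ineq3[of "z + w" z] by simp
  then have "(b - a)\<^sup>2 \<le> (norm w)\<^sup>2"
    using abs_le_square_iff[of "b - a" "norm w"] by simp
  then have "0 \<le> ((norm w)\<^sup>2 - (b - a)\<^sup>2) * ((b + 2 * a) / (2 * a ^ 3 * b))"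
    using ab by (intro mult_nonneg_nonneg) auto
  also have "\<dots> = 1 / a - (z \<bullet> w) / a ^ 3 + (norm w)\<^sup>2 / (a\<^sup>2 * b) - 1 / b"
    using ab unfolding zw by (simp add: field_simps power2_eq_square power3_eq_cube)
  finally show ?thesis
    by (simp add: a_def b_def)
qed

text \<open>The linear term shows that the mass matrix applied to the acceleration is the gradient
  of the potential. The separation hypotheses make the remainder uniform.\<close>

lemma pair_potential_add_le:
  assumes m: "m > 0" and \<delta>: "\<delta> > 0"
    and x: "\<And>i j. i \<noteq> j \<Longrightarrow> \<delta> \<le> norm (x $ i - x $ j)"
    and xw: "\<And>i j. i \<noteq> j \<Longrightarrow> \<delta> / 2 \<le> norm ((x + w) $ i - (x + w) $ j)"
  shows "pair_potential m (x + w) \<le> pair_potential m x + weight (mass m) (acceleration m x) \<bullet> w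
    + (\<Sum>i\<in>UNIV. \<Sum>j\<in>{i<..}. mass m i * mass m j * (8 / \<delta> ^ 3)) * (norm w)\<^sup>2"
proof -
  let ?g = "\<lambda>i j. mass m i * (mass m j / norm (x $ j - x $ i) ^ 3) * ((x $ j - x $ i) \<bullet> w $ i)"
  have "weight (mass m) (acceleration m x) \<bullet> w = (\<Sum>i\<in>UNIV. \<Sum>j\<in>UNIV - {i}. ?g i j)"
    by (simp add: weight_inner acceleration_def inner_sum_left sum_distrib_left mult.assoc)
  also have "\<dots> = (\<Sum>i\<in>UNIV. \<Sum>j\<in>{i<..}. ?g i j + ?g j i)"
    by (rule sum_pairs[symmetric])
  finally have acc: "weight (mass m) (acceleration m x) \<bullet> w = \<dots>" .
  have "mass m i * mass m j / norm ((x + w) $ i - (x + w) $ j)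
      \<le> mass m i * mass m j / norm (x $ i - x $ j) + (?g i j + ?g j i)
        + mass m i * mass m j * (8 / \<delta> ^ 3) * (norm w)\<^sup>2" if "i \<noteq> j" for i j
  proof -
    define z where "z = x $ i - x $ j"
    define u where "u = w $ i - w $ j"
    have zu: "(x + w) $ i - (x + w) $ j = z + u"
      by (simp add: z_def u_def)
    have z1: "\<delta> \<le> norm z"
      using x[OF that] by (simp add: z_def)
    have z2: "\<delta> / 2 \<le> norm (z + u)"
      using xw[OF that] unfolding zu .
    note z = z1 z2
    then have "1 / norm (z + u) \<le> 1 / norm z - (z \<bullet> u) / norm z ^ 3 + (norm u)\<^sup>2 / ((norm z)\<^sup>2 * norm (z + u))"
      using \<delta> by (intro inverse_norm_add_le) auto
    \<comment> \<open>The constant 8 arises from norm u \<le> 2 * norm w in the numerator and the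
      factors \<delta> squared and \<delta> / 2 in the denominator.\<close>
    moreover have "(norm u)\<^sup>2 / ((norm z)\<^sup>2 * norm (z + u)) \<le> (2 * norm w)\<^sup>2 / (\<delta>\<^sup>2 * (\<delta> / 2))"
    proof (intro frac_le mult_mono power_mono)
      show "norm u \<le> 2 * norm w"
        using norm_triangle_ineq4[of "w $ i" "w $ j"]
          Finite_Cartesian_Product.norm_nth_le[of w i] Finite_Cartesian_Product.norm_nth_le[of w j]
        by (simp add: u_def)
    qed (use z \<delta> in auto)
    moreover have "(2 * norm w)\<^sup>2 / (\<delta>\<^sup>2 * (\<delta> / 2)) = 8 / \<delta> ^ 3 * (norm w)\<^sup>2"
      using \<delta> by (simp add: power2_eq_square power3_eq_cube)
    ultimately have "1 / norm (z + u) \<le> 1 / norm z - (z \<bullet> u) / norm z ^ 3 + 8 / \<delta> ^ 3 * (norm w)\<^sup>2"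
      by linarith
    then have "mass m i * mass m j * (1 / norm (z + u))
        \<le> mass m i * mass m j * (1 / norm z - (z \<bullet> u) / norm z ^ 3 + 8 / \<delta> ^ 3 * (norm w)\<^sup>2)"
      using mass_pos[OF m] by (intro mult_left_mono) (auto intro: less_imp_le)
    moreover have "?g i j + ?g j i = - (mass m i * mass m j) * ((z \<bullet> u) / norm z ^ 3)"
      by (simp add: z_def u_def norm_minus_commute[of "x $ j"] inner_diff_left inner_diff_right
          algebra_simps add_divide_distrib diff_divide_distrib)
    ultimately show ?thesis
      unfolding zu by (simp add: z_def[symmetric] algebra_simps)
  qed
  then have "pair_potential m (x + w) \<le> (\<Sum>i\<in>UNIV. \<Sum>j\<in>{i<..}.
      mass m i * mass m j / norm (x $ i - x $ j) + (?g i j + ?g j i)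
        + mass m i * mass m j * (8 / \<delta> ^ 3) * (norm w)\<^sup>2)"
    unfolding pair_potential_def by (intro sum_mono) auto
  then show ?thesis
    unfolding acc by (simp only: pair_potential_def sum.distrib sum_distrib_right)
qed

lemma borel_measurable_potential: "potential m \<in> borel_measurable borel"
proof -
  have [measurable]: "(\<lambda>x :: complex ^ 4. norm (x $ i - x $ j)) \<in> borel_measurable borel" for i j
    by (intro borel_measurable_continuous_onI continuous_intros)
  show ?thesis
    unfolding potential_def[abs_def] by measurable
qed

text \<open>Inversion is continuous on all of \<open>ennreal\<close>, so collisions in the limit are
  covered, as Fatou's lemma requires.\<close>

lemma tendsto_potential:
  assumes "(f \<longlongrightarrow> x) F"
  shows "((\<lambda>n. potential m (f n)) \<longlongrightarrow> potential m x) F"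
proof -
  have "((\<lambda>n. inverse (ennreal (norm (f n $ i - f n $ j))))
      \<longlongrightarrow> inverse (ennreal (norm (x $ i - x $ j)))) F" for i j
    by (intro continuous_on_tendsto_compose[OF continuous_on_inverse_ennreal[OF continuous_on_id, of UNIV]]
        tendsto_ennrealI tendsto_norm tendsto_diff tendsto_vec_nth assms) auto
  then show ?thesis
    unfolding potential_def divide_ennreal_def by (intro tendsto_sum ennreal_tendsto_cmult) auto
qed

lemma continuous_on_acceleration:
  assumes "continuous_on S x" "\<And>t i j. t \<in> S \<Longrightarrow> i \<noteq> j \<Longrightarrow> x t $ i \<noteq> x t $ j"
  shows "continuous_on S (\<lambda>t. acceleration m (x t))"
  unfolding acceleration_def
  by (intro continuous_intros assms(1)) (use assms(2) in auto)

lemma continuous_on_pair_potential: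
  assumes "continuous_on S x" "\<And>t i j. t \<in> S \<Longrightarrow> i \<noteq> j \<Longrightarrow> x t $ i \<noteq> x t $ j"
  shows "continuous_on S (\<lambda>t. pair_potential m (x t))"
  unfolding pair_potential_def
  by (intro continuous_intros assms(1)) (use assms(2) in auto)

section \<open>Action and Sobolev norm computed with any derivative\<close>

text \<open>The kinetic part is always a finite real number, so only the potential can make the
  action infinite.\<close>

lemma action_eq:
  assumes m: "m > 0" and x: "has_L2_derivative T x v"
  shows "action T m x = ennreal (LINT t|period_measure T. kinetic m (v t))
    + (\<integral>\<^sup>+t. potential m (x t) \<partial>period_measure T)"
proof -
  have L: "has_L2_derivative T x (L2_derivative T x)"
    and ae: "AE t in period_measure T. L2_derivative T x t = v t"
    using L2_derivative[OF x] by auto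
  have int: "integrable (period_measure T) (\<lambda>t. kinetic m (v t))"
    unfolding kinetic_eq_inner by (intro integrable_divide integrable_kinetic[OF x])
  have [measurable]: "(\<lambda>t. kinetic m (v t)) \<in> borel_measurable (period_measure T)"
    using int by (rule borel_measurable_integrable)
  have [measurable]: "(\<lambda>t. potential m (x t)) \<in> borel_measurable (period_measure T)"
    using continuous_measurable_period_measure[OF has_L2_derivative_continuous_on[OF x]]
      borel_measurable_potential by (rule measurable_compose)
  have "action T m x =
      (\<integral>\<^sup>+t. ennreal (kinetic m (L2_derivative T x t)) + potential m (x t) \<partial>period_measure T)"
    unfolding action_def by (simp add: nn_integral_restrict_space)
  also have "\<dots> = (\<integral>\<^sup>+t. ennreal (kinetic m (v t)) + potential m (x t) \<partial>period_measure T)"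
    using ae by (intro nn_integral_cong_AE) auto
  also have "\<dots> = (\<integral>\<^sup>+t. ennreal (kinetic m (v t)) \<partial>period_measure T)
      + (\<integral>\<^sup>+t. potential m (x t) \<partial>period_measure T)"
    by (intro nn_integral_add) measurable
  also have "(\<integral>\<^sup>+t. ennreal (kinetic m (v t)) \<partial>period_measure T)
      = ennreal (LINT t|period_measure T. kinetic m (v t))"
    using int kinetic_nonneg[OF m] by (intro nn_integral_eq_integral) auto
  finally show ?thesis .
qed

lemma H1_norm_eq:
  assumes x: "has_L2_derivative T x v"
  shows "H1_norm T x = sqrt (LINT t|period_measure T. (norm (x t))\<^sup>2 + (norm (v t))\<^sup>2)"
proof -
  note L = L2_derivative[OF x]
  have c: "(\<lambda>t. (norm (x t))\<^sup>2) \<in> borel_measurable (period_measure T)"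
    by (intro continuous_measurable_period_measure continuous_intros has_L2_derivative_continuous_on[OF x])
  have "H1_norm T x = sqrt (LINT t|period_measure T. (norm (x t))\<^sup>2 + (norm (L2_derivative T x t))\<^sup>2)"
    by (simp add: H1_norm_def integral_period_measure)
  also have "(LINT t|period_measure T. (norm (x t))\<^sup>2 + (norm (L2_derivative T x t))\<^sup>2)
      = (LINT t|period_measure T. (norm (x t))\<^sup>2 + (norm (v t))\<^sup>2)"
    by (intro integral_cong_AE borel_measurable_add borel_measurable_power c
        measurable_compose[OF _ borel_measurable_norm] has_L2_derivative_measurable[OF L(1)]
        has_L2_derivative_measurable[OF x]) (use L(2) in auto)
  finally show ?thesis .
qed

section \<open>Minimizing the action over reversible loops\<close>

text \<open>Finiteness of a allows moving it to the other side as y - a, where the liminf can be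
  bounded alone.\<close>

lemma ennreal_le_liminf:
  fixes a :: ennreal and f :: "nat \<Rightarrow> ennreal"
  assumes "\<And>n. n \<ge> N \<Longrightarrow> a + f n \<le> y" "a < top_class.top"
  shows "a + liminf f \<le> y"
proof -
  have "a + f N \<le> y"
    using assms(1) by simp
  then have "a \<le> y"
    using order_trans[of a "a + f N" y] by simp
  have "f n \<le> y - a" if "n \<ge> N" for n
    using assms(1)[OF that] assms(2)
    by (metis add_diff_self_ennreal ennreal_add_diff_cancel_left ennreal_minus_mono infinity_ennreal_def
        le_iff_add linorder_not_less order_refl top.not_eq_extremum)
  then have "liminf f \<le> y - a"
    by (intro Liminf_le) (auto simp: eventually_sequentially)
  then have "a + liminf f \<le> a + (y - a)"
    by (rule add_left_mono)
  also have "\<dots> = y"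
    using \<open>a \<le> y\<close> by (rule add_diff_inverse_ennreal)
  finally show ?thesis .
qed

text \<open>The group problem reduced to what the analysis sees: two linear symmetries, coupled with
  the time reflections t \<mapsto> b1 - t and t \<mapsto> b2 - t. Equivariance of the acceleration
  makes its periodic double primitive an admissible loop.\<close>

locale reversible_problem =
  fixes T m b1 b2 :: real and A1 A2 :: "complex ^ 4 \<Rightarrow> complex ^ 4"
  assumes T: "T > 0" and m: "m > 0" and A1: "linear A1" and A2: "linear A2"
    and fixed: "\<And>c. A1 c = c \<Longrightarrow> A2 c = c \<Longrightarrow> c = 0"
    and acceleration_A1: "\<And>x. acceleration m (A1 x) = A1 (acceleration m x)"
    and acceleration_A2: "\<And>x. acceleration m (A2 x) = A2 (acceleration m x)"
begin

definition loops :: "(real \<Rightarrow> complex ^ 4) set" where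
  "loops = {x \<in> H1_loops T (config_space m).
     \<forall>t. x t = A1 (x (b1 - t)) \<and> x t = A2 (x (b2 - t))}"

lemma loopsD:
  assumes "x \<in> loops"
  shows "x (t + T) = x t" "x t \<in> config_space m" "has_L2_derivative T x (L2_derivative T x)"
    "x t = A1 (x (b1 - t))" "x t = A2 (x (b2 - t))"
proof -
  obtain v where "has_L2_derivative T x v"
    using assms by (auto simp: loops_def H1_loops_def)
  then show "has_L2_derivative T x (L2_derivative T x)"
    by (rule L2_derivative)
qed (use assms in \<open>unfold loops_def H1_loops_def, blast\<close>)+

lemma loopsI:
  assumes "\<And>t. x (t + T) = x t" "\<And>t. x t \<in> config_space m" "has_L2_derivative T x v"
    "\<And>t. x t = A1 (x (b1 - t))" "\<And>t. x t = A2 (x (b2 - t))"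
  shows "x \<in> loops"
  using assms unfolding loops_def H1_loops_def by blast

lemma linear_momentum: "linear (\<lambda>x :: complex ^ 4. \<Sum>i\<in>UNIV. mass m i *\<^sub>R x $ i)"
  by (auto simp: linear_iff sum.distrib scaleR_add_right scaleR_sum_right intro!: sum.cong)

lemma config_space_iff: "x \<in> config_space m \<longleftrightarrow> (\<Sum>i\<in>UNIV. mass m i *\<^sub>R x $ i) = 0"
  by (simp add: config_space_def)

text \<open>Closure in this form supplies both the competitors x - \<epsilon> y and the direction x
  - q.\<close>

lemma loops_diff_scaleR:
  assumes x: "x \<in> loops" and y: "y \<in> loops"
  shows "(\<lambda>t. x t - c *\<^sub>R y t) \<in> loops"
proof (rule loopsI)
  show "x (t + T) - c *\<^sub>R y (t + T) = x t - c *\<^sub>R y t" for t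
    by (simp only: loopsD(1)[OF x] loopsD(1)[OF y])
  show "has_L2_derivative T (\<lambda>t. x t - c *\<^sub>R y t) (\<lambda>t. L2_derivative T x t - c *\<^sub>R L2_derivative T y t)"
    by (intro has_L2_derivative_diff has_L2_derivative_scaleR loopsD x y)
  show "x t - c *\<^sub>R y t \<in> config_space m" for t
  proof -
    have "(\<Sum>i\<in>UNIV. mass m i *\<^sub>R (x t - c *\<^sub>R y t) $ i)
        = (\<Sum>i\<in>UNIV. mass m i *\<^sub>R x t $ i) - c *\<^sub>R (\<Sum>i\<in>UNIV. mass m i *\<^sub>R y t $ i)"
      by (simp add: scaleR_diff_right sum_subtractf scaleR_sum_right mult.commute)
    then show ?thesis
      using loopsD(2)[OF x, of t] loopsD(2)[OF y, of t] unfolding config_space_iff by simp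
  qed
  show "x t - c *\<^sub>R y t = A1 (x (b1 - t) - c *\<^sub>R y (b1 - t))" for t
    unfolding linear_diff[OF A1] linear_cmul[OF A1]
    using loopsD(4)[OF x, of t] loopsD(4)[OF y, of t] by metis
  show "x t - c *\<^sub>R y t = A2 (x (b2 - t) - c *\<^sub>R y (b2 - t))" for t
    unfolding linear_diff[OF A2] linear_cmul[OF A2]
    using loopsD(5)[OF x, of t] loopsD(5)[OF y, of t] by metis
qed

lemma zero_loop: "(\<lambda>_. 0) \<in> loops"
proof (rule loopsI)
  show "has_L2_derivative T (\<lambda>_. 0) (\<lambda>_. 0)"
    by (simp add: has_L2_derivative_iff set_lebesgue_integral_def)
qed (simp_all add: config_space_iff linear_0[OF A1] linear_0[OF A2])

text \<open>
  Both symmetries move \<open>x 0\<close> by at most the oscillation of \<open>x\<close>, and only the zero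
  configuration is fixed by both of them.
\<close>

lemma loops_Poincare:
  obtains K where "K \<ge> 0" "\<And>x v t. x \<in> loops \<Longrightarrow> has_L2_derivative T x v \<Longrightarrow> t \<in> {0..T} \<Longrightarrow>
    norm (x t) \<le> K * sqrt (LINT t|period_measure T. (norm (v t))\<^sup>2)"
proof -
  \<comment> \<open>D vanishes exactly on configurations fixed by both maps, so it is injective, and
    in finite dimension an injective linear map is bounded below.\<close>
  define D where "D c = (A1 c - c, A2 c - c)" for c
  have "linear D"
    unfolding D_def[abs_def]
    by (auto simp: linear_iff linear_add[OF A1] linear_add[OF A2] linear_cmul[OF A1]
        linear_cmul[OF A2] scaleR_diff_right)
  moreover have "inj D"
    unfolding linear_injective_0[OF \<open>linear D\<close>] using fixed by (simp add: D_def zero_prod_def)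
  ultimately obtain B where B: "B > 0" "\<And>c. B * norm c \<le> norm (D c)"
    by (rule linear_inj_bounded_below_pos) (rule that)
  obtain K1 where K1: "K1 \<ge> 0" "\<And>c. norm (A1 c) \<le> norm c * K1"
    using bounded_linear.nonneg_bounded[OF A1[unfolded linear_conv_bounded_linear]] by auto
  obtain K2 where K2: "K2 \<ge> 0" "\<And>c. norm (A2 c) \<le> norm c * K2"
    using bounded_linear.nonneg_bounded[OF A2[unfolded linear_conv_bounded_linear]] by auto
  define K where "K = sqrt T * (1 + (K1 + K2) / B)"
  show thesis
  proof (rule that[of K])
    show "K \<ge> 0"
      using T B(1) K1(1) K2(1) by (simp add: K_def)
    fix x v t assume x: "x \<in> loops" and v: "has_L2_derivative T x v" and t: "t \<in> {0..T}"
    define E where "E = sqrt T * sqrt (LINT t|period_measure T. (norm (v t))\<^sup>2)"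
    have osc: "norm (x s - x s') \<le> E" if "s \<in> {0..T}" "s' \<in> {0..T}" for s s'
    proof -
      have "norm (x s - x s') \<le> sqrt \<bar>s - s'\<bar> * sqrt (LINT t|period_measure T. (norm (v t))\<^sup>2)"
        using that by (intro has_L2_derivative_Holder[OF v])
      also have "\<dots> \<le> E"
        unfolding E_def using that by (intro mult_right_mono) auto
      finally show ?thesis .
    qed
    have osc0: "norm (x 0 - x s) \<le> E" for s
      using osc[of 0 "s rmod T"] rmod_in_period[OF T, of s] T
        periodic_rmod[where x = x, OF loopsD(1)[OF x], of s] by simp
    \<comment> \<open>The symmetry at time 0 reads x 0 = A (x b), hence A (x 0) - x 0 = A (x 0 - x
      b), an oscillation of x.\<close>
    have move: "norm (A c - c) \<le> E * K'" if "linear A" "\<And>c. norm (A c) \<le> norm c * K'" "K' \<ge> 0"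
      "c = A (x b)" "c = x 0" for A K' b c
    proof -
      have "norm (A c - c) = norm (A (x 0 - x b))"
        using that(4,5) by (metis linear_diff[OF that(1)])
      also have "\<dots> \<le> E * K'"
        using that(2)[of "x 0 - x b"] mult_right_mono[OF osc0 that(3), of b] by linarith
      finally show ?thesis .
    qed
    have "norm (D (x 0)) \<le> norm (A1 (x 0) - x 0) + norm (A2 (x 0) - x 0)"
      unfolding D_def by (rule norm_Pair_le)
    also have "\<dots> \<le> E * K1 + E * K2"
      using loopsD(4)[OF x, of 0] loopsD(5)[OF x, of 0]
      by (intro add_mono move[OF A1 K1(2,1) _ refl, of b1] move[OF A2 K2(2,1) _ refl, of b2]) auto
    finally have "B * norm (x 0) \<le> E * (K1 + K2)"
      using B(2)[of "x 0"] by (simp add: distrib_left)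
    then have "norm (x 0) \<le> E * ((K1 + K2) / B)"
      using B(1) by (simp add: field_simps)
    moreover have "norm (x t) \<le> norm (x 0) + norm (x t - x 0)"
      using norm_triangle_sub[of "x t" "x 0"] .
    ultimately have "norm (x t) \<le> E * (1 + (K1 + K2) / B)"
      using osc[of t 0] t T by (simp add: distrib_left)
    then show "norm (x t) \<le> K * sqrt (LINT t|period_measure T. (norm (v t))\<^sup>2)"
      by (simp add: E_def K_def mult.commute mult.left_commute)
  qed
qed

lemma kinetic_integral_lower_bound:
  assumes v: "has_L2_derivative T x v"
  shows "min 1 m / 2 * (LINT t|period_measure T. (norm (v t))\<^sup>2)
    \<le> (LINT t|period_measure T. kinetic m (v t))"
proof -
  have "(LINT t|period_measure T. min 1 m / 2 * (norm (v t))\<^sup>2)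
      \<le> (LINT t|period_measure T. kinetic m (v t))"
  proof (rule integral_mono)
    show "integrable (period_measure T) (\<lambda>t. kinetic m (v t))"
      unfolding kinetic_eq_inner by (intro integrable_divide integrable_kinetic[OF v])
    show "integrable (period_measure T) (\<lambda>t. min 1 m / 2 * (norm (v t))\<^sup>2)"
      by (intro integrable_mult_right has_L2_derivative_square_integrable[OF v])
  qed (rule kinetic_lower_bound)
  then show ?thesis
    by simp
qed

lemma loops_coercive: "coercive_on T loops (action T m)"
  unfolding coercive_on_def
proof
  fix C :: real
  obtain K where K: "K \<ge> 0" "\<And>x v t. x \<in> loops \<Longrightarrow> has_L2_derivative T x v \<Longrightarrow> t \<in> {0..T} \<Longrightarrow>
      norm (x t) \<le> K * sqrt (LINT t|period_measure T. (norm (v t))\<^sup>2)"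
    by (rule loops_Poincare) (rule that)
  define \<kappa> where "\<kappa> = min 1 m / 2"
  have \<kappa>: "\<kappa> > 0"
    using m by (simp add: \<kappa>_def)
  \<comment> \<open>The squared sup bound integrated over the period contributes
    \<open>K\<^sup>2 * T\<close>, the derivative contributes 1; so c times the energy bounds the
    squared H1 norm.\<close>
  define c where "c = K\<^sup>2 * T + 1"
  have c: "c > 0"
    using T by (simp add: c_def add_nonneg_pos)
  have "ennreal C \<le> action T m x" if x: "x \<in> loops" and large: "sqrt (c * \<bar>C\<bar> / \<kappa>) \<le> H1_norm T x" for x
  proof -
    define v where "v = L2_derivative T x"
    have v: "has_L2_derivative T x v"
      unfolding v_def by (rule loopsD(3)[OF x])
    define E where "E = (LINT t|period_measure T. (norm (v t))\<^sup>2)"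
    have E: "E \<ge> 0"
      by (simp add: E_def)
    have cont: "continuous_on {0..T} x"
      by (rule has_L2_derivative_continuous_on[OF v])
    have int: "integrable (period_measure T) (\<lambda>t. (norm (x t))\<^sup>2)"
      by (intro continuous_integrable_period_measure continuous_intros cont)
    have "(norm (x t))\<^sup>2 \<le> K\<^sup>2 * E" if "t \<in> {0..T}" for t
      using power_mono[OF K(2)[OF x v that], of 2] E
      by (simp add: power_mult_distrib E_def[symmetric])
    then have "(LINT t|period_measure T. (norm (x t))\<^sup>2) \<le> (LINT t|period_measure T. K\<^sup>2 * E)"
      by (intro integral_mono int) (auto simp: space_restrict_space)
    also have "\<dots> = K\<^sup>2 * E * T"
      using T by (simp add: measure_restrict_space space_restrict_space)
    finally have "(LINT t|period_measure T. (norm (x t))\<^sup>2) + E \<le> c * E"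
      by (simp add: c_def algebra_simps)
    then have "H1_norm T x \<le> sqrt (c * E)"
      unfolding H1_norm_eq[OF v] using int has_L2_derivative_square_integrable[OF v]
      by (simp add: E_def)
    then have "c * \<bar>C\<bar> / \<kappa> \<le> c * E"
      using large by (meson order_trans real_sqrt_le_iff)
    then have "\<bar>C\<bar> \<le> \<kappa> * E"
      using c \<kappa> by (simp add: field_simps)
    then have "C \<le> (LINT t|period_measure T. kinetic m (v t))"
      using kinetic_integral_lower_bound[OF v] by (simp add: \<kappa>_def E_def)
    then have "ennreal C \<le> ennreal (LINT t|period_measure T. kinetic m (v t))"
      by (rule ennreal_leI)
    also have "\<dots> \<le> action T m x"
      unfolding action_eq[OF m v] by simp
    finally show ?thesis .
  qed
  then show "\<exists>R. \<forall>x\<in>loops. R \<le> H1_norm T x \<longrightarrow> ennreal C \<le> action T m x"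
    by blast
qed

text \<open>Arzela-Ascoli: the energy bound gives a uniform bound through
  \<open>loops_Poincare\<close> and equicontinuity through the Holder estimate.\<close>

lemma bounded_loops_subsequence:
  assumes xs: "\<And>n::nat. xs n \<in> loops"
    and bound: "\<And>n. (LINT t|period_measure T. kinetic m (L2_derivative T (xs n) t)) \<le> C"
  obtains x and k :: "nat \<Rightarrow> nat" where "strict_mono k"
    "uniform_limit {0..T} (\<lambda>n. xs (k n)) x sequentially" "\<And>t. (\<lambda>n. xs (k n) t) \<longlonglongrightarrow> x t"
proof -
  define v where "v n = L2_derivative T (xs n)" for n
  have v: "has_L2_derivative T (xs n) (v n)" for n
    unfolding v_def by (rule loopsD(3)[OF xs])
  define E where "E = sqrt (C / (min 1 m / 2))"
  have vE: "sqrt (LINT t|period_measure T. (norm (v n t))\<^sup>2) \<le> E" for n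
  proof -
    have "min 1 m / 2 * (LINT t|period_measure T. (norm (v n t))\<^sup>2) \<le> C"
      using order_trans[OF kinetic_integral_lower_bound[OF v] bound[folded v_def]] .
    then show ?thesis
      unfolding E_def using m by (intro real_sqrt_le_mono) (simp add: field_simps)
  qed
  then have E: "E \<ge> 0"
    using order_trans[OF real_sqrt_ge_zero] by (metis Bochner_Integration.integral_nonneg zero_le_power2)
  obtain K where K: "K \<ge> 0" "\<And>x v t. x \<in> loops \<Longrightarrow> has_L2_derivative T x v \<Longrightarrow> t \<in> {0..T} \<Longrightarrow>
      norm (x t) \<le> K * sqrt (LINT t|period_measure T. (norm (v t))\<^sup>2)"
    by (rule loops_Poincare) (rule that)
  have Holder: "norm (xs n s - xs n t) \<le> sqrt \<bar>s - t\<bar> * E" if "s \<in> {0..T}" "t \<in> {0..T}" for n s t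
    by (rule order_trans[OF has_L2_derivative_Holder[OF v[of n] that(2,1)]])
      (intro mult_left_mono vE, simp)
  obtain g and k :: "nat \<Rightarrow> nat" where k: "strict_mono k"
    and g: "\<And>e. 0 < e \<Longrightarrow> \<exists>N. \<forall>n t. n \<ge> N \<and> t \<in> {0..T} \<longrightarrow> norm (xs (k n) t - g t) < e"
  proof (rule Arzela_Ascoli[of "{0..T}" xs "K * E"])
    show "norm (xs n t) \<le> K * E" if "t \<in> {0..T}" for n t
      using K(2)[OF xs v that, of n] mult_left_mono[OF vE[of n] K(1)] by linarith
    fix s e :: real assume s: "s \<in> {0..T}" and e: "0 < e"
    show "\<exists>d>0. \<forall>n t. t \<in> {0..T} \<and> norm (s - t) < d \<longrightarrow> norm (xs n s - xs n t) < e"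
    \<comment> \<open>This radius inverts the Holder modulus; E + 1 replaces E to avoid dividing by
      zero.\<close>
    proof (intro exI[of _ "(e / (E + 1))\<^sup>2"] conjI allI impI)
      show "0 < (e / (E + 1))\<^sup>2"
        using e E by simp
      fix n t assume t: "t \<in> {0..T} \<and> norm (s - t) < (e / (E + 1))\<^sup>2"
      then have "sqrt \<bar>s - t\<bar> < sqrt ((e / (E + 1))\<^sup>2)"
        by (intro real_sqrt_less_mono) simp
      also have "\<dots> = e / (E + 1)"
        using e E by simp
      finally have "sqrt \<bar>s - t\<bar> * (E + 1) < e"
        using E by (simp add: field_simps)
      moreover have "sqrt \<bar>s - t\<bar> * E \<le> sqrt \<bar>s - t\<bar> * (E + 1)"
        by (intro mult_left_mono) auto
      ultimately show "norm (xs n s - xs n t) < e"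
        using Holder[OF s, of t n] t by linarith
    qed
  qed auto
  have lim: "(\<lambda>n. xs (k n) t) \<longlonglongrightarrow> g t" if "t \<in> {0..T}" for t
  proof (rule LIMSEQ_I)
    fix e :: real assume "0 < e"
    then show "\<exists>N. \<forall>n\<ge>N. norm (xs (k n) t - g t) < e"
      using g[of e] that by blast
  qed
  \<comment> \<open>Arzela-Ascoli determines g only on one period, so the limit is extended
    periodically.\<close>
  define x where "x t = g (t rmod T)" for t
  have xlim: "(\<lambda>n. xs (k n) t) \<longlonglongrightarrow> x t" for t
    using lim[OF rmod_in_period[OF T, of t]] unfolding x_def
    by (simp only: periodic_rmod[where x = "xs _", OF loopsD(1)[OF xs]])
  have gx: "g t = x t" if "t \<in> {0..T}" for t
    using LIMSEQ_unique[OF lim[OF that] xlim] .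
  have "uniform_limit {0..T} (\<lambda>n. xs (k n)) x sequentially"
  proof (rule uniform_limitI)
    fix e :: real assume "0 < e"
    then show "\<forall>\<^sub>F n in sequentially. \<forall>t\<in>{0..T}. dist (xs (k n) t) (x t) < e"
      using g[of e] gx unfolding eventually_sequentially dist_norm by metis
  qed
  with k show thesis
    by (rule that) (rule xlim)
qed

text \<open>The direct method: a minimizing sequence has a uniformly convergent subsequence, and its
  limit is a loop whose action is at most the infimum.\<close>

lemma minimizer_exists:
  assumes "\<exists>x\<in>loops. action T m x < top_class.top"
  shows "\<exists>x. is_arg_min (action T m) (\<lambda>y. y \<in> loops) x"
proof -
  define I where "I = (INF x\<in>loops. action T m x)"
  have I: "I < top_class.top"
    using assms unfolding I_def by (auto simp: INF_less_iff)
  have lower: "I \<le> action T m x" if "x \<in> loops" for x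
    unfolding I_def using that by (rule INF_lower)
  have "\<exists>x\<in>loops. action T m x < I + ennreal (1 / Suc n)" for n
  proof -
    \<comment> \<open>Strictness depends on I being finite.\<close>
    have "I < I + ennreal (1 / Suc n)"
      using I by (cases I) (simp_all add: ennreal_less_iff flip: ennreal_plus)
    then show ?thesis
      unfolding I_def by (simp add: INF_less_iff)
  qed
  then obtain xs where xs: "\<And>n. xs n \<in> loops" "\<And>n. action T m (xs n) < I + ennreal (1 / Suc n)"
    by metis
  define kin where "kin x = (LINT t|period_measure T. kinetic m (L2_derivative T x t))" for x
  have kin_nonneg: "kin x \<ge> 0" for x
    unfolding kin_def by (intro Bochner_Integration.integral_nonneg kinetic_nonneg m)
  define pot where "pot x = (\<integral>\<^sup>+t. potential m (x t) \<partial>period_measure T)" for x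
  have action: "action T m x = ennreal (kin x) + pot x" if "x \<in> loops" for x
    unfolding kin_def pot_def using m loopsD(3)[OF that] by (rule action_eq)
  have kin_bound: "kin (xs n) \<le> enn2real I + 1" for n
  proof -
    have "ennreal (kin (xs n)) \<le> action T m (xs n)"
      unfolding action[OF xs(1)] by simp
    also have "\<dots> \<le> I + ennreal (1 / Suc n)"
      using xs(2) by (rule less_imp_le)
    also have "\<dots> \<le> ennreal (enn2real I) + ennreal 1"
      using I by (intro add_mono ennreal_leI) (auto simp: less_top)
    also have "\<dots> = ennreal (enn2real I + 1)"
      by (rule ennreal_plus[symmetric]) simp_all
    finally show ?thesis
      by (subst (asm) ennreal_le_iff) simp_all
  qed
  obtain x1 k1 where k1: "strict_mono k1" "uniform_limit {0..T} (\<lambda>n. xs (k1 n)) x1 sequentially"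
    "\<And>t. (\<lambda>n. xs (k1 n) t) \<longlonglongrightarrow> x1 t"
    by (rule bounded_loops_subsequence[OF xs(1) kin_bound[unfolded kin_def]]) (rule that)
  have "\<forall>n. kin (xs (k1 n)) \<in> {0..enn2real I + 1}"
    using kin_bound kin_nonneg by simp
  \<comment> \<open>Kinetic energy may drop in the limit. A further subsequence with convergent
    energies allows kinetic and potential parts to be bounded separately and recombined.\<close>
  then obtain \<kappa> r where r: "strict_mono r" "((\<lambda>n. kin (xs (k1 n))) \<circ> r) \<longlonglongrightarrow> \<kappa>"
    using seq_compactE[OF compact_imp_seq_compact[OF compact_Icc]] by metis
  note r = r[unfolded o_def]
  define ys where "ys n = xs (k1 (r n))" for n
  have ys: "ys n \<in> loops" for n
    by (simp add: ys_def xs)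
  have ys_le: "action T m (ys n) \<le> I + ennreal (1 / Suc n)" for n
  proof -
    have "n \<le> k1 (r n)"
      using seq_suble[OF k1(1), of "r n"] seq_suble[OF r(1), of n] by simp
    then have "I + ennreal (1 / Suc (k1 (r n))) \<le> I + ennreal (1 / Suc n)"
      by (intro add_left_mono ennreal_leI) (simp add: frac_le)
    then show ?thesis
      using xs(2)[of "k1 (r n)"] unfolding ys_def by (meson less_imp_le order_trans)
  qed
  have ulim: "uniform_limit {0..T} ys x1 sequentially"
    unfolding ys_def by (rule filterlim_compose[OF k1(2) filterlim_subseq[OF r(1)]])
  have lim: "(\<lambda>n. ys n t) \<longlonglongrightarrow> x1 t" for t
    unfolding ys_def using LIMSEQ_subseq_LIMSEQ[OF k1(3) r(1)] by (simp add: o_def)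
  \<comment> \<open>The semicontinuity lemma wants one bound for all indices, so it is applied to a
    shifted sequence, with e to spare.\<close>
  have tail: "\<exists>w. has_L2_derivative T x1 w \<and> (LINT t|period_measure T. kinetic m (w t)) \<le> \<kappa> + e"
    if "e > 0" for e
  proof -
    obtain N where N: "\<And>n. n \<ge> N \<Longrightarrow> kin (ys n) < \<kappa> + e"
      using order_tendstoD(2)[OF r(2), of "\<kappa> + e"] \<open>e > 0\<close>
      by (auto simp: eventually_sequentially ys_def)
    have "uniform_limit {0..T} (\<lambda>n. ys (n + N)) x1 sequentially"
      using ulim unfolding uniform_limit_iff eventually_sequentially by (meson trans_le_add1)
    moreover have "(LINT t|period_measure T. kinetic m (L2_derivative T (ys (n + N)) t)) \<le> \<kappa> + e" for n
      using N[of "n + N"] by (simp add: kin_def)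
    ultimately obtain w where "has_L2_derivative T x1 w"
      "(LINT t|period_measure T. kinetic m (w t)) \<le> \<kappa> + e"
      using kinetic_integral_lower_semicontinuous[where xs = "\<lambda>n. ys (n + N)" and x = x1,
        OF m loopsD(3)[OF ys]] by metis
    then show ?thesis
      by blast
  qed
  obtain w where w: "has_L2_derivative T x1 w"
    using tail[of 1] by (metis zero_less_one)
  \<comment> \<open>The derivative found in \<open>tail\<close> depends on e, but the kinetic energy
    does not, by uniqueness almost everywhere.\<close>
  have kin_x1: "kin x1 \<le> \<kappa> + e" if "e > 0" for e
  proof -
    obtain w where w: "has_L2_derivative T x1 w" "(LINT t|period_measure T. kinetic m (w t)) \<le> \<kappa> + e"
      using tail[OF \<open>e > 0\<close>] by blast
    note L = L2_derivative[OF w(1)]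
    have "kin x1 = (LINT t|period_measure T. kinetic m (w t))"
      unfolding kin_def kinetic_eq_inner
      by (intro integral_cong_AE borel_measurable_integrable[OF integrable_divide[OF integrable_kinetic[OF L(1)]]]
          borel_measurable_integrable[OF integrable_divide[OF integrable_kinetic[OF w(1)]]])
        (use L(2) in auto)
    then show ?thesis
      using w(2) by simp
  qed
  have x1: "x1 \<in> loops"
  proof (rule loopsI[OF _ _ w])
    show "x1 (t + T) = x1 t" for t
      by (rule LIMSEQ_unique[OF lim[of "t + T"]]) (simp only: loopsD(1)[OF ys] lim)
    have "(\<lambda>n. \<Sum>i\<in>UNIV. mass m i *\<^sub>R ys n t $ i) \<longlonglongrightarrow> (\<Sum>i\<in>UNIV. mass m i *\<^sub>R x1 t $ i)" for t
      by (intro tendsto_intros lim)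
    then have "(\<lambda>n. 0) \<longlonglongrightarrow> (\<Sum>i\<in>UNIV. mass m i *\<^sub>R x1 t $ i)" for t
      by (simp only: loopsD(2)[OF ys, unfolded config_space_iff])
    then show "x1 t \<in> config_space m" for t
      unfolding config_space_iff using LIMSEQ_unique tendsto_const by metis
    show "x1 t = A1 (x1 (b1 - t))" for t
    proof (rule LIMSEQ_unique[OF lim])
      have "(\<lambda>n. A1 (ys n (b1 - t))) \<longlonglongrightarrow> A1 (x1 (b1 - t))"
        by (rule bounded_linear.tendsto[OF A1[unfolded linear_conv_bounded_linear] lim])
      then show "(\<lambda>n. ys n t) \<longlonglongrightarrow> A1 (x1 (b1 - t))"
        by (simp only: loopsD(4)[OF ys, symmetric])
    qed
    show "x1 t = A2 (x1 (b2 - t))" for t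
    proof (rule LIMSEQ_unique[OF lim])
      have "(\<lambda>n. A2 (ys n (b2 - t))) \<longlonglongrightarrow> A2 (x1 (b2 - t))"
        by (rule bounded_linear.tendsto[OF A2[unfolded linear_conv_bounded_linear] lim])
      then show "(\<lambda>n. ys n t) \<longlonglongrightarrow> A2 (x1 (b2 - t))"
        by (simp only: loopsD(5)[OF ys, symmetric])
    qed
  qed
  have pot_x1: "pot x1 \<le> liminf (\<lambda>n. pot (ys n))"
  proof -
    have "(\<lambda>t. potential m (ys n t)) \<in> borel_measurable (period_measure T)" for n
      using continuous_measurable_period_measure[OF has_L2_derivative_continuous_on[OF loopsD(3)[OF ys]]]
        borel_measurable_potential by (rule measurable_compose)
    moreover have "potential m (x1 t) = liminf (\<lambda>n. potential m (ys n t))" for t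
      using lim_imp_Liminf[OF _ tendsto_potential[OF lim[of t]]] by (metis trivial_limit_sequentially)
    ultimately show ?thesis
      unfolding pot_def by (simp add: nn_integral_liminf)
  qed
  \<comment> \<open>Budget: e / 4 from \<open>kin_x1\<close> and e / 4 from convergence to \<kappa>
    compare the kinetic energies, and the remaining e / 2 absorbs the defect 1 / Suc n of the
    minimizing sequence.\<close>
  have "action T m x1 \<le> I + ennreal e" if "e > 0" for e
  proof -
    obtain N1 where N1: "\<And>n. n \<ge> N1 \<Longrightarrow> \<kappa> - e / 4 < kin (ys n)"
      using order_tendstoD(1)[OF r(2), of "\<kappa> - e / 4"] \<open>e > 0\<close>
      by (auto simp: eventually_sequentially ys_def)
    obtain N2 :: nat where N2: "1 / real (Suc N2) < e / 2"
      using nat_approx_posE[of "e / 2"] \<open>e > 0\<close> by (metis half_gt_zero)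
    have "ennreal (kin x1) + pot (ys n) \<le> I + ennreal e" if "n \<ge> max N1 N2" for n
    proof -
      have "kin x1 \<le> kin (ys n) + e / 2"
        using kin_x1[of "e / 4"] N1[of n] that \<open>e > 0\<close> by simp
      then have "ennreal (kin x1) \<le> ennreal (kin (ys n)) + ennreal (e / 2)"
        using kin_nonneg \<open>e > 0\<close> by (simp add: ennreal_plus[symmetric] del: ennreal_plus)
      then have "ennreal (kin x1) + pot (ys n) \<le> (ennreal (kin (ys n)) + ennreal (e / 2)) + pot (ys n)"
        by (rule add_right_mono)
      also have "\<dots> = action T m (ys n) + ennreal (e / 2)"
        by (simp add: action[OF ys] ac_simps)
      also have "\<dots> \<le> I + ennreal (1 / Suc n) + ennreal (e / 2)"
        using ys_le by (rule add_right_mono)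
      also have "\<dots> \<le> I + ennreal (e / 2) + ennreal (e / 2)"
      proof (intro add_mono order_refl ennreal_leI)
        have "1 / real (Suc n) \<le> 1 / real (Suc N2)"
          using that by (simp add: frac_le)
        then show "1 / real (Suc n) \<le> e / 2"
          using N2 by linarith
      qed
      also have "\<dots> = I + ennreal e"
        using \<open>e > 0\<close> by (simp add: add.assoc ennreal_plus[symmetric] del: ennreal_plus)
      finally show ?thesis .
    qed
    then have "ennreal (kin x1) + liminf (\<lambda>n. pot (ys n)) \<le> I + ennreal e"
      by (intro ennreal_le_liminf[where N = "max N1 N2"]) simp_all
    then show ?thesis
      unfolding action[OF x1] by (rule order_trans[OF add_left_mono[OF pot_x1]])
  qed
  then have "action T m x1 \<le> I"
    by (rule ennreal_le_epsilon)
  then have "\<not> action T m y < action T m x1" if "y \<in> loops" for y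
    using lower[OF that] by (simp add: not_less)
  then show ?thesis
    unfolding is_arg_min_def using x1 by blast
qed

end

section \<open>Newton's equations for collision-free minimizers\<close>

context reversible_problem
begin

lemma loop_continuous: "x \<in> loops \<Longrightarrow> continuous_on UNIV x"
  by (rule periodic_continuous[where x = x, OF loopsD(1) T
        has_L2_derivative_continuous_on[OF loopsD(3)]])

lemma loop_bounded:
  assumes "x \<in> loops"
  obtains B where "B > 0" "\<And>t. t \<in> {0..T} \<Longrightarrow> norm (x t) \<le> B"
proof -
  have "compact (x ` {0..T})"
    by (intro compact_continuous_image compact_Icc
        has_L2_derivative_continuous_on[OF loopsD(3)[OF assms]])
  then have "bounded (x ` {0..T})"
    by (rule compact_imp_bounded)
  then obtain B where "B > 0" "\<forall>y\<in>x ` {0..T}. norm y \<le> B"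
    unfolding bounded_pos by blast
  then show thesis
    by (intro that[of B]) auto
qed

lemma collision_free_separated:
  assumes x: "x \<in> loops" and free: "collision_free x"
  obtains \<delta> where "\<delta> > 0" "\<And>t i j. t \<in> {0..T} \<Longrightarrow> i \<noteq> j \<Longrightarrow> \<delta> \<le> norm (x t $ i - x t $ j)"
proof -
  have "\<exists>d>0. \<forall>t\<in>{0..T}. i \<noteq> j \<longrightarrow> d \<le> norm (x t $ i - x t $ j)" for i j
  proof (cases "i = j")
    case False
    have "continuous_on {0..T} x"
      by (rule has_L2_derivative_continuous_on[OF loopsD(3)[OF x]])
    then have "continuous_on {0..T} (\<lambda>t. norm (x t $ i - x t $ j))"
      by (intro continuous_intros)
    then obtain s where "s \<in> {0..T}" and s: "\<forall>t\<in>{0..T}. norm (x s $ i - x s $ j) \<le> norm (x t $ i - x t $ j)"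
      using continuous_attains_inf[OF compact_Icc, of 0 T "\<lambda>t. norm (x t $ i - x t $ j)"] T by auto
    moreover have "norm (x s $ i - x s $ j) > 0"
      using free False by (simp add: collision_free_def)
    ultimately show ?thesis
      by blast
  qed (auto intro: exI[of _ 1])
  then obtain d where d: "\<And>i j. d i j > 0"
    "\<And>i j t. t \<in> {0..T} \<Longrightarrow> i \<noteq> j \<Longrightarrow> d i j \<le> norm (x t $ i - x t $ j)"
    by metis
  \<comment> \<open>The minimum runs over the diagonal as well, where \<open>d\<close> is positive
    but carries no information.\<close>
  define \<delta> where "\<delta> = Min (range (\<lambda>(i, j). d i j))"
  show thesis
  proof (rule that[of \<delta>])
    show "\<delta> > 0"
      unfolding \<delta>_def using d(1) by (subst Min_gr_iff) auto
    fix t i j assume "t \<in> {0..T}" "(i :: 4) \<noteq> j"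
    moreover have "\<delta> \<le> d i j"
      unfolding \<delta>_def by (rule Min_le) (auto intro: rev_image_eqI[of "(i, j)"])
    ultimately show "\<delta> \<le> norm (x t $ i - x t $ j)"
      using d(2) order_trans by blast
  qed
qed

text \<open>Off collisions the action is a real number, so the comparison with a competitor can be
  rearranged in the reals.\<close>

lemma action_eq_real:
  assumes x: "x \<in> loops" and v: "has_L2_derivative T x v"
    and free: "\<And>t i j. t \<in> {0..T} \<Longrightarrow> i \<noteq> j \<Longrightarrow> x t $ i \<noteq> x t $ j"
  shows "action T m x = ennreal ((LINT t|period_measure T. kinetic m (v t))
      + (LINT t|period_measure T. pair_potential m (x t)))"
    and "integrable (period_measure T) (\<lambda>t. pair_potential m (x t))"
proof -
  have "continuous_on {0..T} (\<lambda>t. pair_potential m (x t))"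
    by (intro continuous_on_pair_potential free has_L2_derivative_continuous_on[OF v])
  then show int: "integrable (period_measure T) (\<lambda>t. pair_potential m (x t))"
    by (rule continuous_integrable_period_measure)
  have "(\<integral>\<^sup>+t. potential m (x t) \<partial>period_measure T)
      = (\<integral>\<^sup>+t. ennreal (pair_potential m (x t)) \<partial>period_measure T)"
    by (intro nn_integral_cong potential_eq_pair_potential m free) (auto simp: space_restrict_space)
  also have "\<dots> = ennreal (LINT t|period_measure T. pair_potential m (x t))"
    by (intro nn_integral_eq_integral int AE_I2 pair_potential_nonneg m)
  finally show "action T m x = ennreal ((LINT t|period_measure T. kinetic m (v t))
      + (LINT t|period_measure T. pair_potential m (x t)))"
    unfolding action_eq[OF m v]
    by (subst ennreal_plus)
      (auto intro!: Bochner_Integration.integral_nonneg kinetic_nonneg pair_potential_nonneg m)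
qed

text \<open>Comparing x with x - \<epsilon> y bounds the first variation by \<epsilon> times a
  constant, and \<epsilon> tends to 0 from the right.\<close>

lemma minimizer_first_variation:
  assumes x: "x \<in> loops" and min: "\<And>y. y \<in> loops \<Longrightarrow> action T m x \<le> action T m y"
    and free: "collision_free x" and y: "y \<in> loops"
    and v: "has_L2_derivative T x v" and w: "has_L2_derivative T y w"
  shows "(LINT t|period_measure T. weight (mass m) (v t) \<bullet> w t)
    + (LINT t|period_measure T. weight (mass m) (acceleration m (x t)) \<bullet> y t) \<le> 0"
proof -
  let ?M = "period_measure T"
  obtain \<delta> where \<delta>: "\<delta> > 0" "\<And>t i j. t \<in> {0..T} \<Longrightarrow> i \<noteq> j \<Longrightarrow> \<delta> \<le> norm (x t $ i - x t $ j)"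
    by (rule collision_free_separated[OF x free]) (rule that)
  obtain B where B: "B > 0" "\<And>t. t \<in> {0..T} \<Longrightarrow> norm (y t) \<le> B"
    by (rule loop_bounded[OF y]) (rule that)
  define c where "c = (\<Sum>i\<in>UNIV. \<Sum>j\<in>{i<..}. mass m i * mass m j * (8 / \<delta> ^ 3))"
  have c: "c \<ge> 0"
    unfolding c_def using \<delta>(1)
    by (intro sum_nonneg mult_nonneg_nonneg divide_nonneg_nonneg less_imp_le[OF mass_pos[OF m]]) auto
  define X where "X = (LINT t|?M. weight (mass m) (v t) \<bullet> w t)"
  define Y where "Y = (LINT t|?M. weight (mass m) (acceleration m (x t)) \<bullet> y t)"
  \<comment> \<open>The second-order remainder: exact for the kinetic part, a bound over the period
    for the potential part.\<close>
  define Z where "Z = (LINT t|?M. kinetic m (w t)) + c * B\<^sup>2 * T"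
  have contx: "continuous_on {0..T} x" and conty: "continuous_on {0..T} y"
    by (rule has_L2_derivative_continuous_on[OF v] has_L2_derivative_continuous_on[OF w])+
  have xfree: "x t $ i \<noteq> x t $ j" if "t \<in> {0..T}" "i \<noteq> j" for t i j
    using free that by (simp add: collision_free_def)
  have action_x: "action T m x = ennreal ((LINT t|?M. kinetic m (v t)) + (LINT t|?M. pair_potential m (x t)))"
    and int_x: "integrable ?M (\<lambda>t. pair_potential m (x t))"
    using action_eq_real[OF x v] xfree by blast+
  have wv: "has_L2_derivative T (\<lambda>t. weight (mass m) (x t)) (\<lambda>t. weight (mass m) (v t))"
    by (rule has_L2_derivative_linear[OF linear_weight v])
  have intX: "integrable ?M (\<lambda>t. weight (mass m) (v t) \<bullet> w t)"
    by (rule square_integrable_inner)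
      (rule has_L2_derivative_measurable[OF wv] has_L2_derivative_measurable[OF w]
        has_L2_derivative_square_integrable[OF wv] has_L2_derivative_square_integrable[OF w])+
  have intY: "integrable ?M (\<lambda>t. weight (mass m) (acceleration m (x t)) \<bullet> y t)"
    by (intro continuous_integrable_period_measure continuous_on_inner conty
        linear_continuous_on_compose[OF _ linear_weight] continuous_on_acceleration contx xfree)
  have intkin: "integrable ?M (\<lambda>t. kinetic m (u t))" if "has_L2_derivative T z u" for z u
    unfolding kinetic_eq_inner by (intro integrable_divide integrable_kinetic[OF that])
  \<comment> \<open>The condition on \<epsilon> limits the change of each mutual difference to 2 * B
    * \<epsilon> \<le> \<delta> / 2, so bodies of the competitor stay \<delta> / 2 apart.\<close>
  have key: "X + Y \<le> \<epsilon> * Z" if \<epsilon>: "0 < \<epsilon>" "\<epsilon> * (4 * B) \<le> \<delta>" for \<epsilon>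
  proof -
    define z where "z t = x t - \<epsilon> *\<^sub>R y t" for t
    have z: "z \<in> loops"
      unfolding z_def by (rule loops_diff_scaleR[OF x y])
    define u where "u t = v t - \<epsilon> *\<^sub>R w t" for t
    have u: "has_L2_derivative T z u"
      unfolding z_def u_def by (intro has_L2_derivative_diff has_L2_derivative_scaleR v w)
    have zsep: "\<delta> / 2 \<le> norm (z t $ i - z t $ j)" if t: "t \<in> {0..T}" and ij: "i \<noteq> j" for t i j
    proof -
      have "norm (y t $ k) \<le> B" for k
        using B(2)[OF t] Finite_Cartesian_Product.norm_nth_le[of "y t" k] by linarith
      then have "norm (y t $ i - y t $ j) \<le> 2 * B"
        using norm_triangle_ineq4[of "y t $ i" "y t $ j"] by (smt (verit))
      then have "norm (\<epsilon> *\<^sub>R (y t $ i - y t $ j)) \<le> \<epsilon> * (2 * B)"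
        using \<epsilon>(1) by simp
      moreover have "z t $ i - z t $ j = (x t $ i - x t $ j) - \<epsilon> *\<^sub>R (y t $ i - y t $ j)"
        by (simp add: z_def algebra_simps)
      ultimately show ?thesis
        using \<delta>(2)[OF t ij] \<epsilon>(2) norm_triangle_ineq2[of "x t $ i - x t $ j" "\<epsilon> *\<^sub>R (y t $ i - y t $ j)"]
        by simp
    qed
    have zfree: "z t $ i \<noteq> z t $ j" if "t \<in> {0..T}" "i \<noteq> j" for t i j
      using zsep[OF that] \<delta>(1) by auto
    have action_z: "action T m z = ennreal ((LINT t|?M. kinetic m (u t)) + (LINT t|?M. pair_potential m (z t)))"
      and int_z: "integrable ?M (\<lambda>t. pair_potential m (z t))"
      using action_eq_real[OF z u] zfree by blast+
    have le: "(LINT t|?M. kinetic m (v t)) + (LINT t|?M. pair_potential m (x t))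
        \<le> (LINT t|?M. kinetic m (u t)) + (LINT t|?M. pair_potential m (z t))"
    proof (subst ennreal_le_iff[symmetric])
      show "0 \<le> (LINT t|?M. kinetic m (u t)) + (LINT t|?M. pair_potential m (z t))"
        by (intro add_nonneg_nonneg Bochner_Integration.integral_nonneg kinetic_nonneg
            pair_potential_nonneg m)
      show "ennreal ((LINT t|?M. kinetic m (v t)) + (LINT t|?M. pair_potential m (x t)))
          \<le> ennreal ((LINT t|?M. kinetic m (u t)) + (LINT t|?M. pair_potential m (z t)))"
        using min[OF z] unfolding action_x action_z .
    qed
    have "kinetic m (u t) = kinetic m (v t) - \<epsilon> * (weight (mass m) (v t) \<bullet> w t) + \<epsilon>\<^sup>2 * kinetic m (w t)" for t
      using weight_inner_commute[of "mass m" "w t" "v t"]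
      by (simp add: kinetic_eq_inner u_def linear_diff[OF linear_weight] linear_cmul[OF linear_weight]
          inner_diff_left inner_diff_right power2_eq_square field_simps)
    then have "(LINT t|?M. kinetic m (u t)) = (LINT t|?M. kinetic m (v t)
        - \<epsilon> * (weight (mass m) (v t) \<bullet> w t) + \<epsilon>\<^sup>2 * kinetic m (w t))"
      by simp
    also have "\<dots> = (LINT t|?M. kinetic m (v t)) - \<epsilon> * X + \<epsilon>\<^sup>2 * (LINT t|?M. kinetic m (w t))"
      using intkin[OF v] intkin[OF w] intX by (simp add: X_def)
    finally have kin: "(LINT t|?M. kinetic m (u t))
        = (LINT t|?M. kinetic m (v t)) - \<epsilon> * X + \<epsilon>\<^sup>2 * (LINT t|?M. kinetic m (w t))" .
    have "pair_potential m (z t) \<le> pair_potential m (x t)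
        - \<epsilon> * (weight (mass m) (acceleration m (x t)) \<bullet> y t) + \<epsilon>\<^sup>2 * (c * B\<^sup>2)" if t: "t \<in> {0..T}" for t
    proof -
      have zt: "z t = x t + - (\<epsilon> *\<^sub>R y t)"
        by (simp add: z_def)
      have "pair_potential m (z t) \<le> pair_potential m (x t)
          + weight (mass m) (acceleration m (x t)) \<bullet> (- (\<epsilon> *\<^sub>R y t)) + c * (norm (- (\<epsilon> *\<^sub>R y t)))\<^sup>2"
        unfolding zt c_def
        by (intro pair_potential_add_le m \<delta>(1) \<delta>(2)[OF t] zsep[OF t, unfolded zt])
      moreover have "c * (norm (- (\<epsilon> *\<^sub>R y t)))\<^sup>2 \<le> c * (\<epsilon>\<^sup>2 * B\<^sup>2)"
        using B(2)[OF t] c by (intro mult_left_mono) (auto simp: power_mult_distrib intro!: mult_left_mono power_mono)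
      ultimately show ?thesis
        by (simp add: mult.left_commute)
    qed
    then have "(LINT t|?M. pair_potential m (z t)) \<le> (LINT t|?M. pair_potential m (x t)
        - \<epsilon> * (weight (mass m) (acceleration m (x t)) \<bullet> y t) + \<epsilon>\<^sup>2 * (c * B\<^sup>2))"
      using int_x int_z intY
      by (intro integral_mono) (auto simp: space_restrict_space)
    also have "\<dots> = (LINT t|?M. pair_potential m (x t)) - \<epsilon> * Y + \<epsilon>\<^sup>2 * (c * B\<^sup>2) * T"
      using int_x intY T
      by (simp add: Y_def measure_restrict_space space_restrict_space)
    finally have "\<epsilon> * (X + Y) \<le> \<epsilon> * (\<epsilon> * Z)"
      using le kin by (simp add: Z_def algebra_simps power2_eq_square)
    then show ?thesis
      using \<epsilon>(1) by simp
  qed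
  have "X + Y \<le> 0"
  proof (rule tendsto_lowerbound)
    show "((\<lambda>\<epsilon>. \<epsilon> * Z) \<longlongrightarrow> 0) (at_right 0)"
      by (auto intro!: tendsto_eq_intros)
    have "\<forall>\<^sub>F \<epsilon> in at_right 0. \<epsilon> < \<delta> / (4 * B)"
      using \<delta>(1) B(1) by (intro order_tendstoD(2)[OF tendsto_ident_at]) simp
    moreover have "\<forall>\<^sub>F \<epsilon> in at_right (0::real). 0 < \<epsilon>"
      by (simp add: eventually_at_right_less)
    ultimately show "\<forall>\<^sub>F \<epsilon> in at_right 0. X + Y \<le> \<epsilon> * Z"
    proof eventually_elim
      case (elim \<epsilon>)
      then show ?case
        using B(1) by (intro key) (simp_all add: field_simps)
    qed
  qed simp
  then show ?thesis
    by (simp add: X_def Y_def)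
qed

text \<open>
  The periodic solution \<open>q\<close> of \<open>q'' = acceleration m x\<close> with zero mean is itself an admissible
  loop. The first variation at \<open>x\<close> in the direction \<open>x - q\<close> is the kinetic energy of \<open>x - q\<close>,
  so \<open>x\<close> and \<open>q\<close> differ by a constant.
\<close>

lemma minimizer_newton:
  assumes x: "x \<in> loops" and min: "\<And>y. y \<in> loops \<Longrightarrow> action T m x \<le> action T m y"
    and free: "collision_free x"
  shows "newton_solution m x"
proof -
  let ?M = "period_measure T"
  let ?W = "weight (mass m)"
  define f where "f t = acceleration m (x t)" for t
  have contf: "continuous_on UNIV f"
    unfolding f_def using free
    by (intro continuous_on_acceleration loop_continuous x) (auto simp: collision_free_def)
  have fT: "f (t + T) = f t" for t
    unfolding f_def by (simp only: loopsD(1)[OF x])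
  have f1: "f t = A1 (f (b1 - t))" for t
    unfolding f_def acceleration_A1[symmetric] by (simp only: loopsD(4)[OF x, symmetric])
  have f2: "f t = A2 (f (b2 - t))" for t
    unfolding f_def acceleration_A2[symmetric] by (simp only: loopsD(5)[OF x, symmetric])
  have lf: "(\<Sum>i\<in>UNIV. mass m i *\<^sub>R f t $ i) = 0" for t
    unfolding f_def by (rule acceleration_momentum)
  obtain p q where q: "\<And>t. (q has_vector_derivative p t) (at t)"
    and p: "\<And>t. (p has_vector_derivative f t) (at t)"
    and qT: "\<And>t. q (t + T) = q t" and pT: "\<And>t. p (t + T) = p t"
    and q1: "\<And>t. q t = A1 (q (b1 - t))" and q2: "\<And>t. q t = A2 (q (b2 - t))"
    and lq: "\<And>t. (\<Sum>i\<in>UNIV. mass m i *\<^sub>R q t $ i) = 0"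
    by (rule symmetric_double_primitive[OF contf fT T A1 A2 linear_momentum f1 f2 lf fixed]) (assumption, assumption, rule that)
  have contp: "continuous_on UNIV p"
    using p by (intro continuous_at_imp_continuous_on ballI has_vector_derivative_continuous)
  have qd: "has_L2_derivative T q p"
    by (rule vector_derivative_has_L2_derivative[OF q contp])
  have ql: "q \<in> loops"
    by (rule loopsI[OF qT _ qd q1 q2]) (simp only: config_space_iff lq)
  define v where "v = L2_derivative T x"
  have v: "has_L2_derivative T x v"
    unfolding v_def by (rule loopsD(3)[OF x])
  define w where "w t = v t - p t" for t
  define y where "y t = x t - q t" for t
  have y: "y \<in> loops"
    using loops_diff_scaleR[OF x ql, of 1] by (simp add: y_def[abs_def])
  have w: "has_L2_derivative T y w"
    unfolding y_def w_def by (rule has_L2_derivative_diff[OF v qd])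
  have Wp: "((\<lambda>t. ?W (p t)) has_vector_derivative ?W (f t)) (at t)" for t
    by (rule bounded_linear.has_vector_derivative[OF linear_weight[unfolded linear_conv_bounded_linear] p])
  have contWf: "continuous_on UNIV (\<lambda>t. ?W (f t))"
    by (intro linear_continuous_on_compose[OF contf linear_weight])
  \<comment> \<open>The boundary terms cancel because p and y are periodic.\<close>
  have parts: "(LINT t|?M. ?W (f t) \<bullet> y t) = - (LINT t|?M. ?W (p t) \<bullet> w t)"
    using integration_by_parts_L2[OF less_imp_le[OF T] Wp contWf w] pT[of 0] loopsD(1)[OF y, of 0]
    by simp
  have ip: "integrable ?M (\<lambda>t. ?W (z t) \<bullet> w t)" if "has_L2_derivative T r z" for r z
  proof -
    have wz: "has_L2_derivative T (\<lambda>t. ?W (r t)) (\<lambda>t. ?W (z t))"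
      by (rule has_L2_derivative_linear[OF linear_weight that])
    show ?thesis
      by (rule square_integrable_inner)
        (rule has_L2_derivative_measurable[OF wz] has_L2_derivative_measurable[OF w]
          has_L2_derivative_square_integrable[OF wz] has_L2_derivative_square_integrable[OF w])+
  qed
  \<comment> \<open>With w = v - p in both slots, half the first variation in direction y is the
    kinetic energy of y, which must therefore vanish.\<close>
  have "(LINT t|?M. kinetic m (w t)) = (LINT t|?M. (?W (v t) \<bullet> w t - ?W (p t) \<bullet> w t) / 2)"
    unfolding kinetic_eq_inner by (simp add: w_def linear_diff[OF linear_weight] inner_diff_left)
  also have "\<dots> = ((LINT t|?M. ?W (v t) \<bullet> w t) - (LINT t|?M. ?W (p t) \<bullet> w t)) / 2"
    using ip[OF v] ip[OF qd] by simp
  also have "\<dots> \<le> 0"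
    using minimizer_first_variation[OF x min free y v w] parts by (simp add: f_def)
  finally have "min 1 m / 2 * (LINT t|?M. (norm (w t))\<^sup>2) \<le> 0"
    using kinetic_integral_lower_bound[OF w] by linarith
  then have "(LINT t|?M. (norm (w t))\<^sup>2) \<le> 0"
    using m by (auto simp: mult_le_0_iff min_le_iff_disj)
  then have w0: "(LINT t|?M. (norm (w t))\<^sup>2) = 0"
    by (simp add: order_antisym)
  have "y t = y 0" if "t \<in> {0..T}" for t
    using has_L2_derivative_Holder[OF w, of 0 t] that T w0 by simp
  then have y0: "y t = y 0" for t
    using periodic_rmod[where x = y, OF loopsD(1)[OF y], of t] rmod_in_period[OF T, of t] by metis
  \<comment> \<open>Regularity comes from this identity: x inherits the velocity p, whose derivative
    is the acceleration along x.\<close>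
  have "x = (\<lambda>t. q t + y 0)"
  proof
    show "x t = q t + y 0" for t
      using y0[of t] by (metis y_def add_diff_cancel_left' add_diff_eq diff_add_cancel)
  qed
  then have xp: "(x has_vector_derivative p t) (at t)" for t
    using has_vector_derivative_add[OF q has_vector_derivative_const[of "y 0"]] by simp
  have "mass m i *\<^sub>R (f t $ i) = (\<Sum>j\<in>UNIV - {i}. (mass m i * mass m j / norm (x t $ j - x t $ i) ^ 3) *\<^sub>R
      (x t $ j - x t $ i))" for t i
    by (simp add: f_def acceleration_def scaleR_sum_right)
  then show ?thesis
    unfolding newton_solution_def using xp p by blast
qed

end

section \<open>The symmetries\<close>

lemma line_reflection_eq:
  assumes "e \<noteq> 0"
  shows "line_reflection e z = e / cnj e * cnj z"
proof -
  have "complex_of_real (2 * (z \<bullet> e)) = z * cnj e + cnj z * e"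
    by (simp add: complex_eq_iff inner_complex_def)
  moreover have "complex_of_real (e \<bullet> e) = e * cnj e"
    by (simp add: complex_eq_iff inner_complex_def)
  ultimately have "line_reflection e z = (z * cnj e + cnj z * e) / (e * cnj e) * e - z"
    by (simp add: line_reflection_def scaleR_conv_of_real del: of_real_mult)
  then show ?thesis
    using assms by (simp add: field_simps)
qed

lemma linear_line_reflection: "e \<noteq> 0 \<Longrightarrow> linear (line_reflection e)"
  by (simp add: linear_iff line_reflection_eq distrib_left scaleR_conv_of_real)

lemma norm_line_reflection: "e \<noteq> 0 \<Longrightarrow> norm (line_reflection e z) = norm z"
  by (simp add: line_reflection_eq norm_mult norm_divide)

text \<open>The unit number e / cnj e encodes the line spanned by e: equal values make f / e
  real.\<close>

lemma in_span_if_div_cnj_eq: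
  assumes "e \<noteq> 0" "f \<noteq> 0" "e / cnj e = f / cnj f"
  shows "f \<in> span {e}"
proof -
  have "cnj (f / e) = f / e"
    using assms by (simp add: field_simps)
  moreover have "z = of_real (Re z)" if "cnj z = z" for z
    using that by (simp add: complex_eq_iff)
  ultimately have "f / e = of_real (Re (f / e))"
    by blast
  then have "f = Re (f / e) *\<^sub>R e"
    using assms(1) by (metis nonzero_divide_eq_eq scaleR_conv_of_real)
  then show ?thesis
    by (metis span_base singletonI span_scale)
qed

text \<open>Opposite values make e * cnj f purely imaginary, and its real part is the inner
  product.\<close>

lemma orthogonal_if_div_cnj_eq_minus:
  assumes "e \<noteq> 0" "f \<noteq> 0" "e / cnj e = - (f / cnj f)"
  shows "orthogonal e f"
proof -
  have "e * cnj f + cnj (e * cnj f) = 0"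
    using assms by (simp add: field_simps)
  moreover have "Re z = 0" if "z + cnj z = 0" for z
    using that unfolding complex_add_cnj by simp
  ultimately have "Re (e * cnj f) = 0"
    by blast
  then show ?thesis
    by (simp add: orthogonal_def inner_complex_def)
qed

text \<open>The index is moved by \<pi> itself, not by its inverse; for the involutions at hand this
  agrees with \<open>config_act\<close>.\<close>

definition permuted_reflection :: "complex \<Rightarrow> (4 \<Rightarrow> 4) \<Rightarrow> complex ^ 4 \<Rightarrow> complex ^ 4" where
  "permuted_reflection e \<pi> x = (\<chi> i. line_reflection e (x $ \<pi> i))"

lemma linear_permuted_reflection: "e \<noteq> 0 \<Longrightarrow> linear (permuted_reflection e \<pi>)"
  using linear_line_reflection[of e]
  by (auto simp: linear_iff permuted_reflection_def vec_eq_iff)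

lemma permuted_reflection_nth:
  "e \<noteq> 0 \<Longrightarrow> permuted_reflection e \<pi> x $ i = e / cnj e * cnj (x $ \<pi> i)"
  by (simp add: permuted_reflection_def line_reflection_eq)

text \<open>A linear isometry commutes with the central pair forces, and relabelling bodies of equal
  mass only reindexes each sum.\<close>

lemma acceleration_permuted_reflection:
  assumes e: "e \<noteq> 0" and \<pi>: "bij \<pi>" "\<And>i. mass m (\<pi> i) = mass m i"
  shows "acceleration m (permuted_reflection e \<pi> x) = permuted_reflection e \<pi> (acceleration m x)"
proof -
  let ?R = "line_reflection e"
  let ?g = "\<lambda>i j. (mass m j / norm (x $ j - x $ i) ^ 3) *\<^sub>R (x $ j - x $ i)"
  note R = linear_line_reflection[OF e]
  have "(\<Sum>j\<in>UNIV - {i}. (mass m j / norm (?R (x $ \<pi> j) - ?R (x $ \<pi> i)) ^ 3) *\<^sub>R (?R (x $ \<pi> j) - ?R (x $ \<pi> i)))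
      = ?R (\<Sum>j\<in>UNIV - {\<pi> i}. ?g (\<pi> i) j)" for i
  proof -
    have "bij_betw \<pi> (UNIV - {i}) (UNIV - {\<pi> i})"
      using \<pi>(1) by (intro bij_betw_subset[OF \<pi>(1)])
        (simp_all add: image_set_diff[OF bij_is_inj] bij_is_surj)
    then have "(\<Sum>j\<in>UNIV - {\<pi> i}. ?g (\<pi> i) j) = (\<Sum>j\<in>UNIV - {i}. ?g (\<pi> i) (\<pi> j))"
      by (rule sum.reindex_bij_betw[symmetric])
    then show ?thesis
      using \<pi>(2) by (simp add: linear_sum[OF R] linear_cmul[OF R] norm_line_reflection[OF e]
          flip: linear_diff[OF R])
  qed
  then show ?thesis
    by (simp add: acceleration_def permuted_reflection_def vec_eq_iff)
qed

lemma transposes_4: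
  "Transposition.transpose 1 2 (1::4) = 2" "Transposition.transpose 1 2 (2::4) = 1"
  "Transposition.transpose 1 2 (3::4) = 3" "Transposition.transpose 1 2 (4::4) = 4"
  "Transposition.transpose 3 4 (1::4) = 1" "Transposition.transpose 3 4 (2::4) = 2"
  "Transposition.transpose 3 4 (3::4) = 4" "Transposition.transpose 3 4 (4::4) = 3"
  by (simp_all add: Transposition.transpose_def)

text \<open>Both symmetries exchange bodies 1 and 2, so a nonzero position would give u1 = u2. The
  second fixes bodies 3 and 4 while the first exchanges them, which would give u1 * u1 = u2 * u2;
  the opposite sign is excluded by non-orthogonality.\<close>

lemma only_zero_fixed:
  assumes e: "e1 \<noteq> 0" "e2 \<noteq> 0" "span {e1} \<noteq> span {e2}" "\<not> orthogonal e1 e2"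
    and 1: "permuted_reflection e1 (Transposition.transpose 1 2 \<circ> Transposition.transpose 3 4) c = c"
    and 2: "permuted_reflection e2 (Transposition.transpose 1 2) c = c"
  shows "c = 0"
proof -
  define u1 where "u1 = e1 / cnj e1"
  define u2 where "u2 = e2 / cnj e2"
  have ne: "u1 \<noteq> u2"
  proof
    assume "u1 = u2"
    then have "e2 \<in> span {e1}" "e1 \<in> span {e2}"
      using in_span_if_div_cnj_eq[OF e(1,2)] in_span_if_div_cnj_eq[OF e(2,1)]
      by (simp_all only: u1_def u2_def)
    then have "span {e1} = span {e2}"
      by (simp add: span_eq)
    then show False
      using e(3) by contradiction
  qed
  have ne': "u1 \<noteq> - u2"
    using orthogonal_if_div_cnj_eq_minus[OF e(1,2)] e(4) unfolding u1_def u2_def by blast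
  have unit: "u1 * cnj u1 = 1"
    using e(1) by (simp add: u1_def)
  have c1: "c $ i = u1 * cnj (c $ (Transposition.transpose 1 2 (Transposition.transpose 3 4 i)))" for i
    unfolding u1_def by (metis 1 comp_apply permuted_reflection_nth[OF e(1)])
  have c2: "c $ i = u2 * cnj (c $ (Transposition.transpose 1 2 i))" for i
    unfolding u2_def by (metis 2 permuted_reflection_nth[OF e(2)])
  have "u1 * cnj (c $ 2) = u2 * cnj (c $ 2)"
    using trans[OF c1[of 1, symmetric] c2[of 1]] unfolding transposes_4 .
  then have "c $ 2 = 0"
    using ne by simp
  moreover have "c $ 1 = 0"
    using c1[of 1] unfolding transposes_4 \<open>c $ 2 = 0\<close> by simp
  moreover have zero: "a = 0" if a: "a = u2 * cnj a" and d: "d = u1 * cnj a" "d = u2 * cnj d" for a d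
  proof (rule ccontr)
    assume "a \<noteq> 0"
    have "u2 * cnj (u1 * cnj a) = u1 * cnj a"
      unfolding d(1)[symmetric] by (rule d(2)[symmetric])
    then have "u2 * (cnj u1 * a) = u1 * cnj a"
      by simp
    moreover have "u2 * (cnj u1 * a) = u2 * (cnj u1 * (u2 * cnj a))"
      unfolding a[symmetric] ..
    ultimately have "(u2 * cnj u1 * u2 - u1) * cnj a = 0"
      by (simp add: left_diff_distrib mult.assoc)
    then have "u1 = u2 * cnj u1 * u2"
      using \<open>a \<noteq> 0\<close> by simp
    then have "u1 * u1 = (u1 * cnj u1) * (u2 * u2)"
      by (metis mult.assoc mult.commute)
    then show False
      using ne ne' unit by (simp add: square_eq_iff)
  qed
  have "c $ 3 = 0"
    by (rule zero[OF c2[of 3, unfolded transposes_4] c1[of 4, unfolded transposes_4]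
          c2[of 4, unfolded transposes_4]])
  moreover have "c $ 4 = 0"
    using c1[of 4] unfolding transposes_4 \<open>c $ 3 = 0\<close> by simp
  ultimately show ?thesis
    by (simp add: vec_eq_iff forall_4)
qed

lemma not_homographic:
  assumes e: "e1 \<noteq> 0" "e2 \<noteq> 0" and free: "collision_free x"
    and 1: "\<And>t. x t = permuted_reflection e1 (Transposition.transpose 1 2 \<circ> Transposition.transpose 3 4) (x (0 - t))"
    and 2: "\<And>t. x t = permuted_reflection e2 (Transposition.transpose 1 2) (x (b - t))"
  shows "\<not> homographic x"
proof
  assume "homographic x"
  then obtain s where s: "\<And>t i. x t $ i = s t * x 0 $ i"
    unfolding homographic_def by blast
  define u1 where "u1 = e1 / cnj e1"
  define u2 where "u2 = e2 / cnj e2"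
  define r where "r = s (b / 2)"
  define c where "c = x 0"
  have xb: "x (b / 2) $ i = r * c $ i" for i
    unfolding r_def c_def by (rule s)
  have c1: "c $ i = u1 * cnj (c $ (Transposition.transpose 1 2 (Transposition.transpose 3 4 i)))" for i
    unfolding u1_def c_def by (metis 1 comp_apply diff_0_right permuted_reflection_nth[OF e(1)])
  \<comment> \<open>The time b / 2 is fixed by t \<mapsto> b - t, so the second symmetry there
    constrains a single configuration.\<close>
  have "x (b / 2) = permuted_reflection e2 (Transposition.transpose 1 2) (x (b / 2))"
    using 2[of "b / 2"] by (simp only: field_sum_of_halves[THEN eq_diff_eq[THEN iffD2], symmetric])
  then have c2: "r * c $ i = u2 * cnj (r * c $ (Transposition.transpose 1 2 i))" for i
    unfolding u2_def xb[symmetric] by (metis permuted_reflection_nth[OF e(2)])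
  have c1: "c $ 1 = u1 * cnj (c $ 2)" "c $ 3 = u1 * cnj (c $ 4)"
    using c1[of 1] c1[of 3] by (simp_all only: transposes_4)
  have c2: "r * c $ 1 = u2 * cnj (r * c $ 2)" "r * c $ 3 = u2 * cnj (r * c $ 3)"
    "r * c $ 4 = u2 * cnj (r * c $ 4)"
    using c2[of 1] c2[of 3] c2[of 4] by (simp_all only: transposes_4)
  \<comment> \<open>A zero factor r would put all bodies at the origin at time b / 2, so absence of
    collisions there gives r \<noteq> 0.\<close>
  have "x 0 $ 1 \<noteq> x 0 $ 2" "x 0 $ 3 \<noteq> x 0 $ 4" "x (b / 2) $ 1 \<noteq> x (b / 2) $ 2"
    using free by (simp_all add: collision_free_def)
  then have ne: "c $ 1 \<noteq> c $ 2" "c $ 3 \<noteq> c $ 4" and r: "r \<noteq> 0"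
    unfolding xb by (auto simp: c_def)
  have "c $ 2 \<noteq> 0"
    using c1(1) ne(1) by auto
  moreover have "r * (u1 * cnj (c $ 2)) = u2 * cnj (r * c $ 2)"
    using c2(1) unfolding c1(1) .
  ultimately have ru: "r * u1 = u2 * cnj r"
    by (simp add: mult.assoc[symmetric])
  have line: "u1 * cnj z = z" if "r * z = u2 * cnj (r * z)" for z
  proof -
    have "r * z = u2 * cnj r * cnj z"
      using that by (simp only: complex_cnj_mult mult.assoc)
    then have "r * z = r * (u1 * cnj z)"
      by (simp only: ru[symmetric] mult.assoc)
    then show ?thesis
      using r by (simp only: mult_cancel_left simp_thms)
  qed
  have "c $ 3 = c $ 4"
    using c1(2) line[OF c2(3)] by (rule trans)
  then show False
    using ne(2) by simp
qed

section \<open>Loops fixed by the group\<close>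

text \<open>Needed to pass from the generators to the whole group. Inverting a product reverses it,
  which matches the order of the nested evaluations in time and in the indices.\<close>

lemma loop_act_mult:
  assumes G: "group G" and \<tau>: "group_action G {0..<T} \<tau>" and \<sigma>: "group_action G UNIV \<sigma>"
    and \<rho>: "group_action G UNIV \<rho>" and T: "T > 0" and g: "g \<in> carrier G" and h: "h \<in> carrier G"
  shows "loop_act G T \<tau> \<rho> \<sigma> (g \<otimes>\<^bsub>G\<^esub> h) x = loop_act G T \<tau> \<rho> \<sigma> g (loop_act G T \<tau> \<rho> \<sigma> h x)"
proof
  fix t
  interpret group G
    by (rule G)
  interpret \<tau>: group_action G "{0..<T}" \<tau>
    by (rule \<tau>)
  interpret \<sigma>: group_action G UNIV \<sigma>
    by (rule \<sigma>)
  interpret \<rho>: group_action G UNIV \<rho>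
    by (rule \<rho>)
  define r where "r = t rmod T"
  have r: "r \<in> {0..<T}"
    using rmod_nonneg[of T t] rmod_less[of T t] T by (simp add: r_def)
  \<comment> \<open>The moved time stays in the fundamental domain, so the inner reduction modulo T
    leaves it unchanged.\<close>
  then have "\<tau> (inv\<^bsub>G\<^esub> g) r \<in> {0..<T}"
    using \<tau>.element_image g inv_closed by blast
  then have "\<tau> (inv\<^bsub>G\<^esub> g) r rmod T = \<tau> (inv\<^bsub>G\<^esub> g) r"
    using T by simp
  moreover have "\<tau> (inv\<^bsub>G\<^esub> (g \<otimes>\<^bsub>G\<^esub> h)) r = \<tau> (inv\<^bsub>G\<^esub> h) (\<tau> (inv\<^bsub>G\<^esub> g) r)"
    using g h r by (simp add: inv_mult_group \<tau>.composition_rule)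
  moreover have "config_act \<rho> \<sigma> (g \<otimes>\<^bsub>G\<^esub> h) y = config_act \<rho> \<sigma> g (config_act \<rho> \<sigma> h y)" for y
  proof -
    have bij: "bij (\<sigma> k)" if "k \<in> carrier G" for k
      using \<sigma>.bij_prop0[OF that] by (simp add: Bij_def)
    have "\<sigma> (g \<otimes>\<^bsub>G\<^esub> h) = \<sigma> g \<circ> \<sigma> h"
      using g h by (auto simp: \<sigma>.composition_rule)
    then have "inv_into UNIV (\<sigma> (g \<otimes>\<^bsub>G\<^esub> h)) i = inv_into UNIV (\<sigma> h) (inv_into UNIV (\<sigma> g) i)" for i
      using o_inv_distrib[OF bij[OF g] bij[OF h]] by simp
    then show ?thesis
      using g h by (simp add: config_act_def vec_eq_iff \<rho>.composition_rule)
  qed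
  ultimately show "loop_act G T \<tau> \<rho> \<sigma> (g \<otimes>\<^bsub>G\<^esub> h) x t = loop_act G T \<tau> \<rho> \<sigma> g (loop_act G T \<tau> \<rho> \<sigma> h x) t"
    by (simp add: loop_act_def r_def[symmetric])
qed

text \<open>Since \<open>loop_act\<close> evaluates at \<open>t rmod T\<close>, even the neutral
  element acts trivially only on periodic functions.\<close>

lemma loop_act_one:
  assumes G: "group G" and \<tau>: "group_action G {0..<T} \<tau>" and \<sigma>: "group_action G UNIV \<sigma>"
    and \<rho>: "group_action G UNIV \<rho>" and T: "T > 0" and x: "\<And>t. x (t + T) = x t"
  shows "loop_act G T \<tau> \<rho> \<sigma> \<one>\<^bsub>G\<^esub> x = x"
proof
  fix t
  interpret group G
    by (rule G)
  have r: "t rmod T \<in> {0..<T}"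
    using rmod_nonneg[of T t] rmod_less[of T t] T by simp
  have "\<tau> \<one>\<^bsub>G\<^esub> (t rmod T) = t rmod T"
    using group_action.id_eq_one[OF \<tau>] r by (metis restrict_apply')
  moreover have "\<sigma> \<one>\<^bsub>G\<^esub> = (\<lambda>i. i)" "\<rho> \<one>\<^bsub>G\<^esub> = (\<lambda>z. z)"
    using group_action.id_eq_one[OF \<sigma>] group_action.id_eq_one[OF \<rho>] by (auto simp: restrict_def)
  moreover have "inv_into UNIV (\<lambda>i. i) = (\<lambda>i :: 4. i)"
    using inv_id by (simp add: id_def)
  ultimately show "loop_act G T \<tau> \<rho> \<sigma> \<one>\<^bsub>G\<^esub> x t = x t"
    using periodic_rmod[where x = x, OF x] by (simp add: loop_act_def config_act_def)
qed

text \<open>For an involution the inverses in \<open>loop_act\<close> disappear, and periodicity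
  absorbs the reductions modulo T.\<close>

lemma loop_act_reflection:
  assumes G: "group G" and h: "h \<in> carrier G" "h \<otimes>\<^bsub>G\<^esub> h = \<one>\<^bsub>G\<^esub>"
    and \<tau>: "\<forall>t\<in>{0..<T}. \<tau> h t = (b - t) rmod T" and \<rho>: "\<rho> h = line_reflection e"
    and \<sigma>: "\<sigma> h \<circ> \<sigma> h = id" and T: "T > 0" and x: "\<And>t. x (t + T) = x t"
  shows "loop_act G T \<tau> \<rho> \<sigma> h x t = permuted_reflection e (\<sigma> h) (x (b - t))"
proof -
  interpret group G
    by (rule G)
  have "inv\<^bsub>G\<^esub> h = h"
    using h by (intro inv_equality)
  moreover have "\<tau> h (t rmod T) = (b - t rmod T) rmod T"
    using \<tau> rmod_nonneg[of T t] rmod_less[of T t] T by simp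
  moreover have "x ((b - t rmod T) rmod T) = x (b - t)"
    by (rule periodic_rcong[where x = x, OF x]) (intro rcong_rmod_left rcong_diff rcong_refl)
  moreover have "inv_into UNIV (\<sigma> h) = \<sigma> h"
    using \<sigma> by (simp add: inv_unique_comp)
  ultimately show ?thesis
    by (simp add: loop_act_def config_act_def permuted_reflection_def \<rho>)
qed

text \<open>Induction over the generated subgroup; both generators are their own inverses.\<close>

lemma symmetric_loops_iff:
  assumes dih: "dihedral G L h1 h2" and \<tau>: "group_action G {0..<T} \<tau>"
    and \<sigma>: "group_action G UNIV \<sigma>" and \<rho>: "group_action G UNIV \<rho>" and T: "T > 0"
  shows "x \<in> symmetric_loops G T m \<tau> \<rho> \<sigma> \<longleftrightarrow> x \<in> H1_loops T (config_space m) \<and>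
    loop_act G T \<tau> \<rho> \<sigma> h1 x = x \<and> loop_act G T \<tau> \<rho> \<sigma> h2 x = x"
proof -
  have G: "group G" and h: "h1 \<in> carrier G" "h2 \<in> carrier G"
    and gen: "generate G {h1, h2} = carrier G"
    and invol: "h1 \<otimes>\<^bsub>G\<^esub> h1 = \<one>\<^bsub>G\<^esub>" "h2 \<otimes>\<^bsub>G\<^esub> h2 = \<one>\<^bsub>G\<^esub>"
    using dih by (auto simp: dihedral_def)
  interpret group G
    by (rule G)
  have inv: "inv\<^bsub>G\<^esub> h1 = h1" "inv\<^bsub>G\<^esub> h2 = h2"
    using h invol by (auto intro: inv_equality)
  have "loop_act G T \<tau> \<rho> \<sigma> g x = x"
    if x: "x \<in> H1_loops T (config_space m)" and fixed: "loop_act G T \<tau> \<rho> \<sigma> h1 x = x"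
      "loop_act G T \<tau> \<rho> \<sigma> h2 x = x" and g: "g \<in> generate G {h1, h2}" for g
    using g
  proof (induction rule: generate.induct)
    case one
    show ?case
      using x by (intro loop_act_one G \<tau> \<sigma> \<rho> T) (simp add: H1_loops_def)
  next
    case (incl g)
    then show ?case
      using fixed by auto
  next
    case (inv g)
    then show ?case
      using fixed \<open>inv\<^bsub>G\<^esub> h1 = h1\<close> \<open>inv\<^bsub>G\<^esub> h2 = h2\<close> by auto
  next
    case (eng g k)
    then have "g \<in> carrier G" "k \<in> carrier G"
      using gen by auto
    then show ?case
      using eng.IH loop_act_mult[OF G \<tau> \<sigma> \<rho> T] by simp
  qed
  then show ?thesis
    using h gen by (auto simp: symmetric_loops_def)
qed

theorem mainTheorem7:
  fixes G :: "('g, 'b) monoid_scheme"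
    and L :: nat and h1 h2 :: 'g
    and T m :: real
    and \<tau> :: "'g \<Rightarrow> real \<Rightarrow> real"
    and \<rho> :: "'g \<Rightarrow> complex \<Rightarrow> complex"
    and \<sigma> :: "'g \<Rightarrow> 4 \<Rightarrow> 4"
    and e1 e2 :: complex
  defines "\<Lambda>G \<equiv> symmetric_loops G T m \<tau> \<rho> \<sigma>"
  assumes "T > 0" and "m > 0"
    and "dihedral G L h1 h2"
    and "group_action G {0..<T} \<tau>"
    and "\<forall>t\<in>{0..<T}. \<tau> h1 t = (- t) rmod T"
    and "\<forall>t\<in>{0..<T}. \<tau> h2 t = (T / real L - t) rmod T"
    and "group_action G UNIV \<sigma>"
    and "\<sigma> h1 = Transposition.transpose 1 2 \<circ> Transposition.transpose 3 4"
    and "\<sigma> h2 = Transposition.transpose 1 2"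
    and "group_action G UNIV \<rho>"
    and "\<forall>g\<in>carrier G. orthogonal_transformation (\<rho> g)"
    and "e1 \<noteq> 0" and "e2 \<noteq> 0"
    and "\<rho> h1 = line_reflection e1" and "\<rho> h2 = line_reflection e2"
    and "span {e1} \<noteq> span {e2}" and "\<not> orthogonal e1 e2"
    and "\<forall>x. local_minimum_on T \<Lambda>G (action T m) x \<longrightarrow> collision_free x"
  shows "coercive_on T \<Lambda>G (action T m) \<and>
         (\<exists>x. is_arg_min (action T m) (\<lambda>y. y \<in> \<Lambda>G) x) \<and>
         (\<forall>x. is_arg_min (action T m) (\<lambda>y. y \<in> \<Lambda>G) x \<longrightarrow>
            collision_free x \<and> (\<forall>t. x (t + T) = x t) \<and> newton_solution m x \<and> \<not> homographic x)"
proof -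
  let ?\<pi>1 = "Transposition.transpose 1 2 \<circ> Transposition.transpose 3 4 :: 4 \<Rightarrow> 4"
  let ?\<pi>2 = "Transposition.transpose 1 2 :: 4 \<Rightarrow> 4"
  define A1 where "A1 = permuted_reflection e1 ?\<pi>1"
  define A2 where "A2 = permuted_reflection e2 ?\<pi>2"
  note T = \<open>T > 0\<close> and m = \<open>m > 0\<close> and e = \<open>e1 \<noteq> 0\<close> \<open>e2 \<noteq> 0\<close>
  \<comment> \<open>Both permutations preserve the pairs 1, 2 and 3, 4 of equal masses.\<close>
  have mass: "mass m (?\<pi>1 i) = mass m i" "mass m (?\<pi>2 i) = mass m i" for i
    using exhaust_4[of i] by (auto simp: transposes_4 mass_def)
  have bij: "bij ?\<pi>1" "bij ?\<pi>2"
    by (simp_all add: bij_comp)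
  interpret reversible_problem T m 0 "T / real L" A1 A2
  proof (rule reversible_problem.intro)
    show "linear A1"
      unfolding A1_def by (rule linear_permuted_reflection[OF e(1)])
    show "linear A2"
      unfolding A2_def by (rule linear_permuted_reflection[OF e(2)])
    show "c = 0" if "A1 c = c" "A2 c = c" for c
      using that unfolding A1_def A2_def
      by (rule only_zero_fixed[OF e \<open>span {e1} \<noteq> span {e2}\<close> \<open>\<not> orthogonal e1 e2\<close>])
    show "acceleration m (A1 x) = A1 (acceleration m x)" for x
      unfolding A1_def by (rule acceleration_permuted_reflection[OF e(1) bij(1) mass(1)])
    show "acceleration m (A2 x) = A2 (acceleration m x)" for x
      unfolding A2_def by (rule acceleration_permuted_reflection[OF e(2) bij(2) mass(2)])
  qed (rule T m)+
  have G: "group G" "h1 \<in> carrier G" "h2 \<in> carrier G"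
    and invol: "h1 \<otimes>\<^bsub>G\<^esub> h1 = \<one>\<^bsub>G\<^esub>" "h2 \<otimes>\<^bsub>G\<^esub> h2 = \<one>\<^bsub>G\<^esub>"
    using \<open>dihedral G L h1 h2\<close> by (auto simp: dihedral_def)
  have \<tau>1: "\<forall>t\<in>{0..<T}. \<tau> h1 t = (0 - t) rmod T"
    using \<open>\<forall>t\<in>{0..<T}. \<tau> h1 t = (- t) rmod T\<close> by simp
  have \<sigma>_invol: "\<sigma> h1 \<circ> \<sigma> h1 = id" "\<sigma> h2 \<circ> \<sigma> h2 = id"
    unfolding \<open>\<sigma> h1 = ?\<pi>1\<close> \<open>\<sigma> h2 = ?\<pi>2\<close>
    by (simp_all add: fun_eq_iff forall_4 transposes_4)
  have loops: "\<Lambda>G = loops"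
  proof (rule Set.set_eqI)
    fix x :: "real \<Rightarrow> complex ^ 4"
    have "loop_act G T \<tau> \<rho> \<sigma> h1 x t = A1 (x (0 - t))" if x: "\<And>t. x (t + T) = x t" for t
      unfolding A1_def \<open>\<sigma> h1 = ?\<pi>1\<close>[symmetric]
      by (rule loop_act_reflection[where x = x and \<tau> = \<tau> and \<rho> = \<rho> and \<sigma> = \<sigma>,
            OF G(1,2) invol(1) \<tau>1 \<open>\<rho> h1 = line_reflection e1\<close> \<sigma>_invol(1) T x])
    moreover have "loop_act G T \<tau> \<rho> \<sigma> h2 x t = A2 (x (T / real L - t))"
      if x: "\<And>t. x (t + T) = x t" for t
      unfolding A2_def \<open>\<sigma> h2 = ?\<pi>2\<close>[symmetric]
      by (rule loop_act_reflection[where x = x and \<tau> = \<tau> and \<rho> = \<rho> and \<sigma> = \<sigma>,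
            OF G(1,3) invol(2) \<open>\<forall>t\<in>{0..<T}. \<tau> h2 t = (T / real L - t) rmod T\<close>
            \<open>\<rho> h2 = line_reflection e2\<close> \<sigma>_invol(2) T x])
    moreover have per: "x (t + T) = x t" if "x \<in> H1_loops T (config_space m)" for t
      using that unfolding H1_loops_def by blast
    ultimately have "loop_act G T \<tau> \<rho> \<sigma> h1 x = x \<and> loop_act G T \<tau> \<rho> \<sigma> h2 x = x \<longleftrightarrow>
        (\<forall>t. x t = A1 (x (0 - t)) \<and> x t = A2 (x (T / real L - t)))" if "x \<in> H1_loops T (config_space m)"
      using that unfolding fun_eq_iff by metis
    then show "x \<in> \<Lambda>G \<longleftrightarrow> x \<in> loops"
      unfolding \<Lambda>G_def loops_def
        symmetric_loops_iff[OF \<open>dihedral G L h1 h2\<close> \<open>group_action G {0..<T} \<tau>\<close>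
          \<open>group_action G UNIV \<sigma>\<close> \<open>group_action G UNIV \<rho>\<close> T]
      by blast
  qed
  \<comment> \<open>A global minimum is a local one for every radius; the radius 1 is used.\<close>
  have local_min_free: "collision_free x" if "x \<in> loops" "\<And>y. y \<in> loops \<Longrightarrow> action T m x \<le> action T m y" for x
    using that \<open>\<forall>x. local_minimum_on T \<Lambda>G (action T m) x \<longrightarrow> collision_free x\<close>
    unfolding loops local_minimum_on_def by (metis zero_less_one)
  have "\<exists>x\<in>loops. action T m x < top_class.top"
  proof (rule ccontr)
    assume "\<not> ?thesis"
    then have "action T m y = top_class.top" if "y \<in> loops" for y
      using that by (metis top.not_eq_extremum)
    then have "collision_free (\<lambda>_. 0)"
      using zero_loop by (intro local_min_free) auto
    then show False
      unfolding collision_free_def by (metis exhaust_4 one_neq_zero zero_index)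
  qed
  then have exists: "\<exists>x. is_arg_min (action T m) (\<lambda>y. y \<in> loops) x"
    by (rule minimizer_exists)
  have "collision_free x \<and> (\<forall>t. x (t + T) = x t) \<and> newton_solution m x \<and> \<not> homographic x"
    if "is_arg_min (action T m) (\<lambda>y. y \<in> loops) x" for x
  proof (intro conjI allI)
    have x: "x \<in> loops"
      using that by (simp add: is_arg_min_def)
    have min: "action T m x \<le> action T m y" if "y \<in> loops" for y
      using that \<open>is_arg_min (action T m) (\<lambda>y. y \<in> loops) x\<close>
      by (auto simp: is_arg_min_def not_less)
    show free: "collision_free x"
      using x min by (rule local_min_free)
    show "x (t + T) = x t" for t
      using x by (rule loopsD(1))
    show "newton_solution m x"
      using x min free by (rule minimizer_newton)
    show "\<not> homographic x"
      using loopsD(4,5)[OF x] unfolding A1_def A2_def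
      by (rule not_homographic[OF e free])
  qed
  with exists show ?thesis
    unfolding loops using loops_coercive by blast
qed

end
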